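(* Let $3\le p\le q$ and $n=p+q$, and let $\mathscr{T}_n^{p,q}$ be the set of all $n$-vertex trees whose bipartition has parts of sizes $p$ and $q$. Let $T_1$ be the tree consisting of a vertex $c$ with exactly $q$ neighbors, of which $q-2$ are leaves and the remaining two, $y_1$ and $y_2$, have respectively $p-2$ and $1$ further pendant vertices attached. Then $T_1$ is the unique tree in $\mathscr{T}_n^{p,q}$ with the second minimal eccentric distance sum.
   Context: All graphs are simple and connected. For a graph $G$ and vertices $u,v$, $d_G(u,v)$ is the distance; $D_G(v)=\sum_{u\in V_G}d_G(u,v)$; the eccentricity $\varepsilon_G(v)$ is the maximum distance from $v$ to any vertex. The eccentric distance sum is $\xi^d(G)=\sum_{v\in V_G}\varepsilon_G(v)D_G(v)$. The tree with the minimal eccentric distance sum in $\mathscr{T}_n^{p,q}$ is the double star obtained from an edge $xy$ by attaching $q-1$ leaves to $x$ and $p-1$ leaves to $y$; "second minimal" refers to the minimum over the remaining trees of $\mathscr{T}_n^{p,q}$. *)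

theory Defs
  imports "Graph_Theory.Graph_Theory"
begin

text \<open>
  A finite simple graph is a \<open>pair_graph\<close>: finite vertex set, irreflexive symmetric arc set, so
  every undirected edge occurs as two opposite arcs.
\<close>

definition gdist :: "'a pair_pre_digraph \<Rightarrow> 'a \<Rightarrow> 'a \<Rightarrow> nat" where
  "gdist G u v = (LEAST k. \<exists>w. pre_digraph.awalk (with_proj G) u w v \<and> length w = k)"

definition distance_sum :: "'a pair_pre_digraph \<Rightarrow> 'a \<Rightarrow> nat" where
  "distance_sum G v = (\<Sum>u\<in>pverts G. gdist G u v)"

definition eccentricity :: "'a pair_pre_digraph \<Rightarrow> 'a \<Rightarrow> nat" where
  "eccentricity G v = Max ((\<lambda>u. gdist G u v) ` pverts G)"

definition eccentric_distance_sum :: "'a pair_pre_digraph \<Rightarrow> nat" where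
  "eccentric_distance_sum G = (\<Sum>v\<in>pverts G. eccentricity G v * distance_sum G v)"

text \<open>
  The library's \<open>tree\<close> is meant for oriented edges: in a symmetric digraph each edge traversed
  back and forth is already a \<open>cycle\<close>. Cycles of the undirected graph are those of length at
  least three.
\<close>

definition undirected_tree :: "'a pair_pre_digraph \<Rightarrow> bool" where
  "undirected_tree G \<longleftrightarrow> pair_graph G \<and> connected (with_proj G) \<and>
     \<not> (\<exists>w. pre_digraph.cycle (with_proj G) w \<and> 3 \<le> length w)"

definition has_bipartition :: "'a pair_pre_digraph \<Rightarrow> nat \<Rightarrow> nat \<Rightarrow> bool" where
  "has_bipartition G p q \<longleftrightarrow> (\<exists>A B. pverts G = A \<union> B \<and> A \<inter> B = {} \<and>
     card A = p \<and> card B = q \<and> parcs G \<subseteq> A \<times> B \<union> B \<times> A)"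

definition bipartite_trees :: "nat \<Rightarrow> nat \<Rightarrow> nat \<Rightarrow> 'a pair_pre_digraph set" where
  "bipartite_trees n p q = {G. undirected_tree G \<and> card (pverts G) = n \<and> has_bipartition G p q}"

abbreviation graph_iso :: "'a pair_pre_digraph \<Rightarrow> 'b pair_pre_digraph \<Rightarrow> bool" where
  "graph_iso G H \<equiv> digraph_iso (with_proj G) (with_proj H)"

definition minimal_eds :: "'a pair_pre_digraph set \<Rightarrow> 'a pair_pre_digraph \<Rightarrow> bool" where
  "minimal_eds \<T> T \<longleftrightarrow> T \<in> \<T> \<and>
     (\<forall>T'\<in>\<T>. eccentric_distance_sum T \<le> eccentric_distance_sum T')"

definition unique_minimal_eds :: "'a pair_pre_digraph set \<Rightarrow> 'a pair_pre_digraph \<Rightarrow> bool" where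
  "unique_minimal_eds \<T> T \<longleftrightarrow> minimal_eds \<T> T \<and> (\<forall>T'. minimal_eds \<T> T' \<longrightarrow> graph_iso T' T)"

text \<open>
  Graphs are considered up to isomorphism: the remaining graphs are those not isomorphic to the
  graph \<open>S\<close> with the minimal eccentric distance sum.
\<close>

definition unique_second_minimal_eds :: "'a pair_pre_digraph set \<Rightarrow> 'a pair_pre_digraph \<Rightarrow> bool" where
  "unique_second_minimal_eds \<T> T \<longleftrightarrow> (\<exists>S. unique_minimal_eds \<T> S \<and>
     unique_minimal_eds {T'\<in>\<T>. \<not> graph_iso T' S} T)"

text \<open>
  \<open>L\<close> consists of the leaves at the centre \<open>c\<close>, while \<open>P1\<close> and \<open>P2\<close> are the pendant vertices
  attached to \<open>y1\<close> and \<open>y2\<close>.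
\<close>

definition is_T1 :: "nat \<Rightarrow> nat \<Rightarrow> 'a pair_pre_digraph \<Rightarrow> bool" where
  "is_T1 p q G \<longleftrightarrow> (\<exists>c y1 y2 L P1 P2.
     distinct [c, y1, y2] \<and> finite L \<and> finite P1 \<and> finite P2 \<and>
     L \<inter> {c, y1, y2} = {} \<and> P1 \<inter> ({c, y1, y2} \<union> L) = {} \<and> P2 \<inter> ({c, y1, y2} \<union> L \<union> P1) = {} \<and>
     card L = q - 2 \<and> card P1 = p - 2 \<and> card P2 = 1 \<and>
     pverts G = {c, y1, y2} \<union> L \<union> P1 \<union> P2 \<and>
     (let E = {c} \<times> ({y1, y2} \<union> L) \<union> {y1} \<times> P1 \<union> {y2} \<times> P2 in parcs G = E \<union> E\<inverse>))"

end

theory Submission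
  imports Defs
begin

text \<open>
  If no vertex of the tree has eccentricity at most 2, then at most one vertex in each part has
  eccentricity 3. Together with the bound \<open>D(v) \<ge> 3q + 2p - 2 - 2 deg v\<close> for \<open>v\<close> in the part of
  size \<open>p\<close>, its mirror image for the other part and \<open>\<Sum>deg v \<le> 2(n - 1)\<close>, this makes the eccentric
  distance sum larger than that of \<open>T\<^sub>1\<close>. Otherwise the tree consists of a centre \<open>c\<close>, its
  neighbours \<open>Y\<close> and further vertices \<open>Z\<close> with parents \<open>f z \<in> Y\<close>. Unless \<open>f\<close> is constant, which
  gives a double star, the eccentric distance sum depends only on \<open>|Y|\<close>, \<open>|Z|\<close> and the sum of the
  squared fibre sizes of \<open>f\<close>. This sum is largest when one fibre contains all but one element of
  \<open>Z\<close>, and having \<open>|Y| = q\<close> is at least as good as \<open>|Y| = p\<close>.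
\<close>

section \<open>Distances\<close>

text \<open>Walks become relation powers, so that distance arguments are inductions over
  \<open>relpow\<close> instead of manipulations of arc lists.\<close>

lemma pcas_relpow:
  "(\<exists>w. pcas u w v \<and> set w \<subseteq> R \<and> length w = k) \<longleftrightarrow> (u, v) \<in> R ^^ k"
proof (induction k arbitrary: u)
  case 0
  show ?case by auto
next
  case (Suc k)
  show ?case
  proof
    assume "\<exists>w. pcas u w v \<and> set w \<subseteq> R \<and> length w = Suc k"
    then obtain w where w: "pcas u w v" "set w \<subseteq> R" "length w = Suc k" by blast
    then obtain e es where "w = e # es" by (cases w) auto
    with w Suc.IH[of "snd e"] show "(u, v) \<in> R ^^ Suc k"
      by (intro relpow_Suc_I2[of u "snd e"]) (cases e, auto)
  next
    assume "(u, v) \<in> R ^^ Suc k"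
    then obtain x where x: "(u, x) \<in> R" "(x, v) \<in> R ^^ k" by (meson relpow_Suc_D2)
    with Suc.IH[of x] obtain w where "pcas x w v" "set w \<subseteq> R" "length w = k" by blast
    with x show "\<exists>w. pcas u w v \<and> set w \<subseteq> R \<and> length w = Suc k"
      by (intro exI[of _ "(u, x) # w"]) auto
  qed
qed

text \<open>The start vertex has to be in the graph because \<open>awalk\<close> demands it even of
  the empty walk, while \<open>parcs G ^^ 0\<close> relates every element to itself.\<close>

lemma gdist_relpow:
  assumes "u \<in> pverts G"
  shows "gdist G u v = (LEAST k. (u, v) \<in> parcs G ^^ k)"
  using assms unfolding gdist_def pcas_relpow[symmetric]
  by (simp add: pre_digraph.awalk_def cas_with_proj_eq conj_commute conj_left_commute)

lemma eccentricity_ge: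
  assumes "finite (pverts G)" "u \<in> pverts G"
  shows "gdist G u v \<le> eccentricity G v"
  using assms by (simp add: eccentricity_def)

lemma eccentricity_eqI:
  assumes "finite (pverts G)" "u \<in> pverts G" "gdist G u v = k"
    and "\<And>x. x \<in> pverts G \<Longrightarrow> gdist G x v \<le> k"
  shows "eccentricity G v = k"
  unfolding eccentricity_def using assms by (intro Max_eqI) auto

section \<open>Bipartitioned trees\<close>

lemma card_le_1:
  assumes "\<And>x y. x \<in> X \<Longrightarrow> y \<in> X \<Longrightarrow> x = y"
  shows "card X \<le> 1"
  using assms card_le_Suc0_iff_eq[of X] by (cases "finite X") auto

text \<open>The parts carry no cardinalities, so exchanging \<open>A\<close> and \<open>B\<close> is
  just another interpretation, and every bound proved for \<open>A\<close> has a mirror image for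
  \<open>B\<close>.\<close>

locale bipartitioned_tree = pair_graph G for G :: "'a pair_pre_digraph" +
  fixes A B :: "'a set"
  assumes connected_G: "connected (with_proj G)"
    and acyclic_G: "\<And>w. cycle w \<Longrightarrow> length w < 3"
    and pverts_eq: "pverts G = A \<union> B"
    and AB_disjoint: "A \<inter> B = {}"
    and parcs_subset: "parcs G \<subseteq> A \<times> B \<union> B \<times> A"
begin

abbreviation "V \<equiv> pverts G"
abbreviation "E \<equiv> parcs G"
abbreviation "d \<equiv> gdist G"

lemma connected_relpow:
  assumes "u \<in> V" "v \<in> V"
  shows "\<exists>k. (u, v) \<in> E ^^ k"
proof -
  have "strongly_connected (with_proj G)"
    using symmetric_connected_imp_strongly_connected connected_G pair_sym_arcs by blast
  then have "u \<rightarrow>\<^sup>*\<^bsub>with_proj G\<^esub> v" using assms by (auto simp: strongly_connected_def)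
  from reachable_rtranclI[OF this] show ?thesis by (simp add: rtrancl_imp_relpow)
qed

lemma dist_relpow:
  assumes "u \<in> V" "v \<in> V"
  shows "(u, v) \<in> E ^^ d u v"
  using LeastI_ex[OF connected_relpow[OF assms]] assms by (simp add: gdist_relpow)

lemma dist_le:
  assumes "u \<in> V" "(u, v) \<in> E ^^ k"
  shows "d u v \<le> k"
  using assms by (simp add: gdist_relpow Least_le)

lemma dist_self [simp]: "u \<in> V \<Longrightarrow> d u u = 0"
  using dist_le[of u u 0] by simp

lemma dist_eq_0_iff:
  assumes "u \<in> V" "v \<in> V"
  shows "d u v = 0 \<longleftrightarrow> u = v"
  using dist_relpow[OF assms] assms by auto

lemma relpow_sym: "(u, v) \<in> E ^^ k \<Longrightarrow> (v, u) \<in> E ^^ k"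
proof (induction k arbitrary: v)
  case (Suc k)
  then obtain x where "(u, x) \<in> E ^^ k" "(x, v) \<in> E" by auto
  with Suc.IH show ?case by (meson arcs_symmetric relpow_Suc_I2)
qed auto

lemma dist_sym:
  assumes "u \<in> V" "v \<in> V"
  shows "d u v = d v u"
  using assms by (intro antisym) (simp_all add: dist_le relpow_sym dist_relpow)

lemma dist_arc_le:
  assumes "u \<in> V" "(v, w) \<in> E"
  shows "d u w \<le> Suc (d u v)"
  using assms in_arcsD1[OF assms(2)] dist_relpow[of u v] by (intro dist_le) auto

lemma ex_parent:
  assumes "u \<in> V" "v \<in> V" "u \<noteq> v"
  obtains w where "(w, v) \<in> E" "d u v = Suc (d u w)"
proof -
  from assms obtain k where k: "d u v = Suc k"
    by (metis dist_eq_0_iff not0_implies_Suc)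
  with dist_relpow[OF assms(1,2)] obtain w where w: "(u, w) \<in> E ^^ k" "(w, v) \<in> E" by auto
  have "d u w \<le> k" using w(1) assms(1) by (rule dist_le[rotated])
  moreover have "d u v \<le> Suc (d u w)" using dist_arc_le[OF assms(1) w(2)] .
  ultimately show ?thesis using that w(2) k by simp
qed

lemma arc_iff:
  assumes "u \<in> V" "v \<in> V"
  shows "(u, v) \<in> E \<longleftrightarrow> d u v = 1"
proof
  assume "(u, v) \<in> E"
  then show "d u v = 1"
    using dist_arc_le[OF assms(1), of u v] assms no_loops'[of u v] dist_eq_0_iff[OF assms]
    by fastforce
next
  assume "d u v = 1"
  then show "(u, v) \<in> E" using dist_relpow[OF assms] by simp
qed

text \<open>Every arc changes the part. Exact distances are later found from an upper bound given by
  a walk together with this parity.\<close>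

lemma relpow_parity:
  "(u, v) \<in> E ^^ k \<Longrightarrow> u \<in> V \<Longrightarrow> even k \<longleftrightarrow> (u \<in> A \<longleftrightarrow> v \<in> A)"
proof (induction k arbitrary: v)
  case (Suc k)
  then obtain x where "(u, x) \<in> E ^^ k" "(x, v) \<in> E" by auto
  with Suc parcs_subset AB_disjoint show ?case by fastforce
qed auto

lemma dist_parity:
  assumes "u \<in> V" "v \<in> V"
  shows "even (d u v) \<longleftrightarrow> (u \<in> A \<longleftrightarrow> v \<in> A)"
  using relpow_parity[OF dist_relpow[OF assms] assms(1)] .

text \<open>Parity rules out horizontal arcs: seen from the root \<open>u\<close>, every arc leads
  to another level.\<close>

lemma dist_arc_neq:
  assumes "u \<in> V" "(v, w) \<in> E"
  shows "d u v \<noteq> d u w"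
proof -
  have "v \<in> A \<longleftrightarrow> w \<notin> A" using assms(2) parcs_subset AB_disjoint by blast
  then show ?thesis
    using dist_parity[OF assms(1)] in_arcsD1[OF assms(2)] in_arcsD2[OF assms(2)] by metis
qed

lemma awalk_within:
  assumes "(u, v) \<in> (E \<inter> F \<times> F)\<^sup>*" "u \<in> V"
  shows "\<exists>w. awalk u w v \<and> set w \<subseteq> F \<times> F"
  using assms
proof (induction rule: converse_rtrancl_induct)
  case base
  then show ?case by (intro exI[of _ "[]"]) (simp add: awalk_Nil_iff)
next
  case (step y z)
  then obtain w where "awalk z w v" "set w \<subseteq> F \<times> F" using in_arcsD2 by blast
  with step show ?case by (intro exI[of _ "(y, z) # w"]) (auto simp: awalk_Cons_iff)
qed

text \<open>
  Two neighbours of \<open>v\<close> that are both closer to \<open>r\<close> are joined by a walk through \<open>r\<close> that avoids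
  \<open>v\<close>, and shortening it to a path closes up to a cycle at \<open>v\<close>.
\<close>

lemma parent_unique:
  assumes r: "r \<in> V" and u: "(u, v) \<in> E" "d r u < d r v" and w: "(w, v) \<in> E" "d r w < d r v"
  shows "u = w"
proof (rule ccontr)
  assume "u \<noteq> w"
  \<comment> \<open>\<open>v\<close> is not in \<open>F\<close>, so a walk inside \<open>F\<close>
    avoids \<open>v\<close>.\<close>
  define F where "F = {x \<in> V. d r x < d r v}"
  let ?R = "(E \<inter> F \<times> F)\<^sup>*"
  have to_root: "(x, r) \<in> ?R" if "x \<in> F" for x
    using that
  proof (induction "d r x" arbitrary: x)
    case 0
    then show ?case using dist_eq_0_iff r by (auto simp: F_def)
  next
    case (Suc k)
    then have x: "x \<in> V" "d r x < d r v" "r \<noteq> x" using r by (auto simp: F_def)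
    obtain y where y: "(y, x) \<in> E" "d r x = Suc (d r y)" using ex_parent r x by blast
    then have "y \<in> F" using x in_arcsD1 by (auto simp: F_def)
    then have "(y, r) \<in> ?R" using Suc y by simp
    moreover have "(x, y) \<in> E \<inter> F \<times> F" using y Suc.prems \<open>y \<in> F\<close> arcs_symmetric by auto
    ultimately show ?case by (rule converse_rtrancl_into_rtrancl[rotated])
  qed
  have uF: "u \<in> F" "w \<in> F" using u w in_arcsD1 by (auto simp: F_def)
  have "sym (E \<inter> F \<times> F)" using arcs_symmetric by (auto intro: symI)
  then have "(r, w) \<in> ?R" using to_root[OF uF(2)] by (meson sym_rtrancl symD)
  then have "(u, w) \<in> ?R" using to_root[OF uF(1)] by auto
  then obtain p where p: "awalk u p w" "set p \<subseteq> F \<times> F"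
    using awalk_within u(1) in_arcsD1 by blast
  \<comment> \<open>\<open>cycle\<close> demands distinct vertices, hence the shortening to a
    path.\<close>
  define q where "q = awalk_to_apath p"
  have q: "apath u q w" "set q \<subseteq> F \<times> F"
    using apath_awalk_to_apath[OF p(1)] awalk_to_apath_subset[OF p(1)] p(2) by (auto simp: q_def)
  have vq: "v \<notin> set (awalk_verts u q)"
  proof -
    have "set (awalk_verts u q) = {u} \<union> set (map fst q) \<union> set (map snd q)"
      using q(1) set_awalk_verts[of u q w] by (auto simp: apath_def)
    also have "\<dots> \<subseteq> F" using q(2) uF by auto
    finally show ?thesis by (auto simp: F_def)
  qed
  have qw: "awalk u q w" "distinct (awalk_verts u q)" using q(1) by (auto simp: apath_def)
  let ?c = "(v, u) # q @ [(w, v)]"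
  have tail: "awalk u (q @ [(w, v)]) v"
    using qw(1) w(1) in_arcsD2 by (intro awalk_appendI[of _ _ w]) (auto simp: awalk_simps)
  have "awalk v ?c v"
    using tail qw(1) arcs_symmetric[OF u(1)] by (simp add: awalk_Cons_iff)
  moreover have "awalk_verts u (q @ [(w, v)]) = awalk_verts u q @ [v]"
    using tail by (subst awalk_verts_append) auto
  then have "distinct (tl (awalk_verts v ?c))"
    using qw(2) vq by simp
  ultimately have "cycle ?c" unfolding cycle_def by blast
  \<comment> \<open>\<open>?c\<close> has length \<open>length q + 2\<close>, so \<open>q\<close> is
    empty and its ends \<open>u\<close> and \<open>w\<close> coincide.\<close>
  from acyclic_G[OF this] have "q = []" by simp
  then show False using qw(1) \<open>u \<noteq> w\<close> by (simp add: awalk_Nil_iff)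
qed

text \<open>Root the tree at \<open>r\<close>. By \<open>parent_unique\<close> an arc leading away
  from \<open>r\<close> is determined by its head and an arc leading towards \<open>r\<close> by its
  tail; in both cases that end is not \<open>r\<close>.\<close>

lemma card_arcs_le: "card E \<le> 2 * (card V - 1)"
proof -
  obtain r where r: "r \<in> V"
    using connected_G by (auto simp: connected_conv)
  let ?up = "{(u, v) \<in> E. d r u < d r v}" and ?dn = "{(u, v) \<in> E. d r v < d r u}"
  have "card ?up \<le> card (V - {r})"
  proof (rule card_inj_on_le[of snd])
    show "inj_on snd ?up"
      using parent_unique[OF r] by (auto intro!: inj_onI)
    show "snd ` ?up \<subseteq> V - {r}"
      using in_arcsD2 r by auto
  qed (simp add: pair_finite_verts)
  moreover have "card ?dn \<le> card (V - {r})"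
  proof (rule card_inj_on_le[of fst])
    show "inj_on fst ?dn"
    proof (rule inj_onI)
      fix a b assume "a \<in> ?dn" "b \<in> ?dn" "fst a = fst b"
      then have "snd a = snd b"
        by (intro parent_unique[OF r, of _ "fst a"]) (auto intro: arcs_symmetric)
      with \<open>fst a = fst b\<close> show "a = b" by (rule prod_eqI)
    qed
    show "fst ` ?dn \<subseteq> V - {r}"
      using in_arcsD1 r by auto
  qed (simp add: pair_finite_verts)
  moreover have "?up \<union> ?dn = E"
    using dist_arc_neq[OF r] by fastforce
  then have "card E \<le> card ?up + card ?dn" using card_Un_le[of ?up ?dn] by argo
  ultimately show ?thesis using r by (simp add: pair_finite_verts)
qed

section \<open>Lower bounds for trees without a vertex of eccentricity at most 2\<close>

lemma finite_A: "finite A" and finite_B: "finite B"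
  using pair_finite_verts by (auto simp: pverts_eq)

lemma bipartitioned_tree_swap: "bipartitioned_tree G B A"
  using connected_G acyclic_G pverts_eq AB_disjoint parcs_subset
  by unfold_locales auto

text \<open>Vertices of the same part have distance at least 2 and those of the other part at least
  3. The exceptions are \<open>v\<close> itself and its neighbours, each of which falls short by 2.
  The deficits are added on the right to avoid truncated subtraction.\<close>

lemma distance_sum_ge:
  assumes v: "v \<in> A"
  shows "3 * card B + 2 * card A \<le> distance_sum G v + 2 * card (E `` {v}) + 2"
proof -
  have vV: "v \<in> V" using v pverts_eq by simp
  have "2 * card A = (\<Sum>u\<in>A. 2)" by simp
  also have "\<dots> \<le> (\<Sum>u\<in>A. d u v + (if u = v then 2 else 0))"
  proof (rule sum_mono)
    fix u assume u: "u \<in> A"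
    then have "u \<in> V" using pverts_eq by simp
    then show "2 \<le> d u v + (if u = v then 2 else 0)"
      using u v vV dist_parity[of u v] dist_eq_0_iff[of u v]
      by (cases "u = v") (auto elim!: evenE)
  qed
  also have "\<dots> = (\<Sum>u\<in>A. d u v) + 2"
    using v finite_A by (simp add: sum.distrib)
  finally have A: "2 * card A \<le> (\<Sum>u\<in>A. d u v) + 2" .
  have nbrs: "E `` {v} = {u \<in> B. (v, u) \<in> E}"
    using parcs_subset v AB_disjoint by auto
  have "3 * card B = (\<Sum>u\<in>B. 3)" by simp
  also have "\<dots> \<le> (\<Sum>u\<in>B. d u v + (if (v, u) \<in> E then 2 else 0))"
  proof (rule sum_mono)
    fix u assume u: "u \<in> B"
    then have uV: "u \<in> V" using pverts_eq by simp
    have "odd (d u v)" using u v vV uV AB_disjoint dist_parity[of u v] by auto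
    then show "3 \<le> d u v + (if (v, u) \<in> E then 2 else 0)"
      using arc_iff[OF vV uV] dist_sym[OF vV uV] by (auto elim!: oddE)
  qed
  also have "\<dots> = (\<Sum>u\<in>B. d u v) + 2 * card (E `` {v})"
    unfolding nbrs using finite_B
    by (simp add: sum.distrib sum.inter_filter[symmetric])
  finally have B: "3 * card B \<le> (\<Sum>u\<in>B. d u v) + 2 * card (E `` {v})" .
  have "distance_sum G v = (\<Sum>u\<in>A. d u v) + (\<Sum>u\<in>B. d u v)"
    unfolding distance_sum_def pverts_eq
    using finite_A finite_B AB_disjoint by (rule sum.union_disjoint)
  with A B show ?thesis by simp
qed

text \<open>
  Two such vertices in the same part have distance 2. Every vertex is farther from one of them
  than from their common neighbour, so that neighbour has eccentricity at most 2.
\<close>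

lemma eccentricity_3_unique:
  assumes ecc: "\<And>v. v \<in> V \<Longrightarrow> 3 \<le> eccentricity G v"
    and x: "x \<in> V" "eccentricity G x \<le> 3" and y: "y \<in> V" "eccentricity G y \<le> 3"
    and same: "x \<in> A \<longleftrightarrow> y \<in> A"
  shows "x = y"
proof (rule ccontr)
  assume "x \<noteq> y"
  have le3: "d v x \<le> 3" "d v y \<le> 3" if "v \<in> V" for v
    using eccentricity_ge[OF pair_finite_verts that] x(2) y(2) le_trans by blast+
  obtain m where m: "(m, y) \<in> E" "d x y = Suc (d x m)"
    using ex_parent[OF x(1) y(1) \<open>x \<noteq> y\<close>] .
  have mV: "m \<in> V" using m in_arcsD1 by blast
  have "d x y \<noteq> 0" "even (d x y)" "d x y \<le> 3"
    using dist_eq_0_iff dist_parity x y \<open>x \<noteq> y\<close> same le3 by simp_all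
  then have "d x y = 2" by (auto elim!: evenE)
  with m have mx: "(x, m) \<in> E" using arc_iff x mV by simp
  have ym: "(y, m) \<in> E" using m arcs_symmetric by blast
  have "d v m \<le> 2" if v: "v \<in> V" for v
  proof (rule ccontr)
    assume "\<not> d v m \<le> 2"
    \<comment> \<open>Parity excludes equality with \<open>d v m\<close>, which is at least 3 here.
      So \<open>x\<close> and \<open>y\<close> would both be parents of \<open>m\<close> in the tree
      rooted at \<open>v\<close>.\<close>
    then have "d v x < d v m" "d v y < d v m"
      using le3[OF v] dist_arc_neq[OF v mx] dist_arc_neq[OF v ym] by linarith+
    with parent_unique[OF v mx _ ym] \<open>x \<noteq> y\<close> show False by blast
  qed
  then have "eccentricity G m \<le> 2"
    unfolding eccentricity_def using pair_finite_verts mV by (subst Max_le_iff) auto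
  with ecc[OF mV] show False by simp
qed

text \<open>Each vertex is charged eccentricity 4, and a full distance bound is given back at the
  exceptional vertices, of which each part has at most one. The degrees enter only through their
  sum, at most \<open>2 * (p + q - 1)\<close>.\<close>

lemma eccentric_distance_sum_ge:
  assumes ecc: "\<And>v. v \<in> V \<Longrightarrow> 3 \<le> eccentricity G v"
    and pq: "int (card A) = p" "int (card B) = q" "1 \<le> p" "1 \<le> q"
  shows "24 * p * q + 8 * p^2 + 8 * q^2 - 29 * p - 29 * q + 20 \<le> int (eccentric_distance_sum G)"
proof -
  \<comment> \<open>\<open>N\<close> is the bound of \<open>distance_sum_ge\<close> without its
    degree term and \<open>L\<close> the full bound; outside \<open>X\<close> the eccentricity is at
    least 4.\<close>
  define N where "N v = (if v \<in> A then 3 * q + 2 * p - 2 else 3 * p + 2 * q - 2)" for v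
  define L where "L v = N v - 2 * int (card (E `` {v}))" for v
  define X where "X = {v \<in> V. eccentricity G v \<le> 3}"
  interpret swap: bipartitioned_tree G B A by (rule bipartitioned_tree_swap)
  have LD: "L v \<le> int (distance_sum G v)" if "v \<in> V" for v
  proof (cases "v \<in> A")
    case True
    with distance_sum_ge[OF True] pq show ?thesis by (simp add: L_def N_def)
  next
    case False
    with that have "v \<in> B" using pverts_eq by simp
    with swap.distance_sum_ge[OF this] False pq show ?thesis by (simp add: L_def N_def)
  qed
  have "4 * L v - (if v \<in> X then N v else 0) \<le> int (eccentricity G v * distance_sum G v)"
    if v: "v \<in> V" for v
  proof (cases "v \<in> X")
    case True
    have "3 * int (distance_sum G v) \<le> int (eccentricity G v * distance_sum G v)"
      using ecc[OF v] by (simp add: mult_right_mono)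
    \<comment> \<open>As \<open>3 * L v = 4 * L v - L v\<close>, giving back \<open>N v\<close>
      instead of \<open>L v\<close> only weakens the bound and keeps degrees out of the sum over
      \<open>X\<close>.\<close>
    moreover have "L v \<le> N v" by (simp add: L_def)
    ultimately have "4 * L v - N v \<le> int (eccentricity G v * distance_sum G v)"
      using LD[OF v] by linarith
    with True show ?thesis by (simp only: if_True)
  next
    case False
    then have "4 * int (distance_sum G v) \<le> int (eccentricity G v * distance_sum G v)"
      using v by (simp add: X_def mult_right_mono)
    then have "4 * L v - 0 \<le> int (eccentricity G v * distance_sum G v)"
      using LD[OF v] by linarith
    with False show ?thesis by (simp only: if_False)
  qed
  then have "(\<Sum>v\<in>V. 4 * L v - (if v \<in> X then N v else 0)) \<le> int (eccentric_distance_sum G)"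
    unfolding eccentric_distance_sum_def of_nat_sum by (rule sum_mono)
  moreover have "(\<Sum>v\<in>V. 4 * L v - (if v \<in> X then N v else 0))
      = 4 * (\<Sum>v\<in>V. N v) - 8 * (\<Sum>v\<in>V. int (card (E `` {v}))) - (\<Sum>v\<in>X. N v)"
  proof -
    have "(\<Sum>v\<in>V. if v \<in> X then N v else 0) = (\<Sum>v\<in>X. N v)"
      using pair_finite_verts by (simp add: X_def sum.inter_filter)
    then show ?thesis
      by (simp add: L_def sum_subtractf sum_distrib_left right_diff_distrib)
  qed
  moreover have "(\<Sum>v\<in>V. N v) = p * (3 * q + 2 * p - 2) + q * (3 * p + 2 * q - 2)"
  proof -
    have "(\<Sum>v\<in>V. N v) = (\<Sum>v\<in>A. N v) + (\<Sum>v\<in>B. N v)"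
      unfolding pverts_eq using finite_A finite_B AB_disjoint by (rule sum.union_disjoint)
    also have "(\<Sum>v\<in>A. N v) = p * (3 * q + 2 * p - 2)" using pq by (simp add: N_def)
    also have "(\<Sum>v\<in>B. N v) = (\<Sum>v\<in>B. 3 * p + 2 * q - 2)"
      using AB_disjoint by (intro sum.cong) (auto simp: N_def)
    finally show ?thesis using pq by simp
  qed
  moreover have "(\<Sum>v\<in>V. int (card (E `` {v}))) \<le> 2 * (p + q - 1)"
  proof -
    \<comment> \<open>Grouping the arcs by their tails turns the degree sum into
      \<open>card E\<close>.\<close>
    have "E = Sigma V (\<lambda>v. E `` {v})" using in_arcsD1 by auto
    then have "card E = card (Sigma V (\<lambda>v. E `` {v}))" by simp
    also have "\<dots> = (\<Sum>v\<in>V. card (E `` {v}))"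
      by (rule card_SigmaI) (auto simp: pair_finite_verts pair_finite_arcs)
    finally have "card E = (\<Sum>v\<in>V. card (E `` {v}))" .
    moreover have "card V = card A + card B"
      unfolding pverts_eq using finite_A finite_B AB_disjoint by (rule card_Un_disjoint)
    ultimately have "(\<Sum>v\<in>V. card (E `` {v})) \<le> 2 * (card A + card B - 1)"
      using card_arcs_le by simp
    moreover have "int (2 * (card A + card B - 1)) = 2 * (p + q - 1)"
      using pq by (simp add: of_nat_diff)
    ultimately have "int (\<Sum>v\<in>V. card (E `` {v})) \<le> 2 * (p + q - 1)"
      by (metis of_nat_mono)
    then show ?thesis by simp
  qed
  moreover have "(\<Sum>v\<in>X. N v) \<le> (3 * q + 2 * p - 2) + (3 * p + 2 * q - 2)"
  proof -
    have fin: "finite (X \<inter> A)" "finite (X \<inter> B)" using finite_A finite_B by auto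
    have X: "X = X \<inter> A \<union> X \<inter> B" using pverts_eq by (auto simp: X_def)
    have "(\<Sum>v\<in>X. N v) = (\<Sum>v\<in>X \<inter> A. N v) + (\<Sum>v\<in>X \<inter> B. N v)"
      by (subst X, rule sum.union_disjoint) (use fin AB_disjoint in auto)
    also have "(\<Sum>v\<in>X \<inter> A. N v) = int (card (X \<inter> A)) * (3 * q + 2 * p - 2)"
      by (simp add: N_def)
    also have "(\<Sum>v\<in>X \<inter> B. N v) = (\<Sum>v\<in>X \<inter> B. 3 * p + 2 * q - 2)"
      using AB_disjoint by (intro sum.cong) (auto simp: N_def)
    also have "\<dots> = int (card (X \<inter> B)) * (3 * p + 2 * q - 2)" by simp
    also have "int (card (X \<inter> A)) * (3 * q + 2 * p - 2) \<le> 1 * (3 * q + 2 * p - 2)"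
    proof (rule mult_right_mono)
      have "card (X \<inter> A) \<le> 1"
        by (rule card_le_1, rule eccentricity_3_unique[OF ecc]) (auto simp: X_def)
      then show "int (card (X \<inter> A)) \<le> 1" by simp
    qed (use pq in simp)
    also have "int (card (X \<inter> B)) * (3 * p + 2 * q - 2) \<le> 1 * (3 * p + 2 * q - 2)"
    proof (rule mult_right_mono)
      have "card (X \<inter> B) \<le> 1"
        by (rule card_le_1, rule swap.eccentricity_3_unique[OF ecc]) (auto simp: X_def)
      then show "int (card (X \<inter> B)) \<le> 1" by simp
    qed (use pq in simp)
    finally show ?thesis by simp
  qed
  ultimately show ?thesis by (simp add: algebra_simps power2_eq_square)
qed

end

section \<open>Trees of radius at most two\<close>

text \<open>A rooted tree of depth at most two: root \<open>c\<close>, children \<open>Y\<close>,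
  grandchildren \<open>Z\<close>, parent map \<open>f\<close>. These data determine the graph, so
  sums and isomorphisms can be read off from them.\<close>

locale two_level =
  fixes G :: "'a pair_pre_digraph" and c :: 'a and Y Z :: "'a set" and f :: "'a \<Rightarrow> 'a"
  assumes finite_Y: "finite Y" and finite_Z: "finite Z"
    and c_notin: "c \<notin> Y" "c \<notin> Z" and YZ_disjoint: "Y \<inter> Z = {}"
    and f_in: "z \<in> Z \<Longrightarrow> f z \<in> Y"
    and verts_G: "pverts G = insert c (Y \<union> Z)"
    and parcs_iff: "(u, v) \<in> parcs G \<longleftrightarrow>
      u = c \<and> v \<in> Y \<or> v = c \<and> u \<in> Y \<or> v \<in> Z \<and> u = f v \<or> u \<in> Z \<and> v = f u"

text \<open>\<open>Y\<close> and \<open>Z\<close> are the vertices at distance 1 and 2 from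
  \<open>c\<close>. As parts alternate between levels, \<open>c\<close> and \<open>Z\<close>
  together form one part.\<close>

lemma (in bipartitioned_tree) two_levelI:
  assumes c: "c \<in> V" "eccentricity G c \<le> 2"
  obtains Y Z f where "two_level G c Y Z f"
    "insert c Z = A \<and> Y = B \<or> insert c Z = B \<and> Y = A"
proof -
  have d2: "d u c \<le> 2" if "u \<in> V" for u
    using eccentricity_ge[OF pair_finite_verts that] c(2) le_trans by blast
  define Y where "Y = {u \<in> V. d c u = 1}"
  define Z where "Z = {u \<in> V. d c u = 2}"
  define f where "f z = (SOME y. (y, z) \<in> E \<and> d c z = Suc (d c y))" for z
  have f: "(f z, z) \<in> E" "d c z = Suc (d c (f z))" if z: "z \<in> Z" for z
  proof -
    have "z \<in> V" "c \<noteq> z" using z c by (auto simp: Z_def)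
    then obtain y where "(y, z) \<in> E \<and> d c z = Suc (d c y)" using ex_parent[OF c(1)] by metis
    then have "(f z, z) \<in> E \<and> d c z = Suc (d c (f z))" unfolding f_def by (rule someI)
    then show "(f z, z) \<in> E" "d c z = Suc (d c (f z))" by auto
  qed
  have fY: "f z \<in> Y" if "z \<in> Z" for z
    using f[OF that] that in_arcsD1 by (auto simp: Y_def Z_def)
  have level: "u = c \<or> d c u = 1 \<or> d c u = 2" if "u \<in> V" for u
    using d2[OF that] dist_sym[OF c(1) that] dist_eq_0_iff[OF c(1) that]
    by (cases "c = u") auto
  then have VYZ: "V = insert c (Y \<union> Z)" using c(1) by (auto simp: Y_def Z_def)
  have Yc: "(c, y) \<in> E" "(y, c) \<in> E" if "y \<in> Y" for y
    using that arc_iff[OF c(1), of y] arcs_symmetric by (auto simp: Y_def)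
  \<comment> \<open>Arcs leading away from \<open>c\<close> start at \<open>c\<close> or at the
    chosen parent; \<open>parent_unique\<close> shows that the choice in \<open>f\<close> was
    forced.\<close>
  have up: "u = c \<and> v \<in> Y \<or> v \<in> Z \<and> u = f v" if uv: "(u, v) \<in> E" "d c u < d c v" for u v
  proof -
    have V: "u \<in> V" "v \<in> V" using uv in_arcsD1 in_arcsD2 by auto
    then consider "v = c" | "v \<in> Y" | "v \<in> Z" using VYZ by auto
    then show ?thesis
    proof cases
      case 2
      then show ?thesis using uv V dist_eq_0_iff[OF c(1)] by (auto simp: Y_def)
    next
      case 3
      then show ?thesis using f[OF 3] parent_unique[OF c(1) uv] by auto
    qed (use uv c in auto)
  qed
  have "two_level G c Y Z f"
  proof
    show "finite Y" "finite Z" using pair_finite_verts VYZ by auto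
    show "(u, v) \<in> E \<longleftrightarrow>
      u = c \<and> v \<in> Y \<or> v = c \<and> u \<in> Y \<or> v \<in> Z \<and> u = f v \<or> u \<in> Z \<and> v = f u" for u v
    proof
      assume uv: "(u, v) \<in> E"
      then consider "d c u < d c v" | "d c v < d c u" using dist_arc_neq[OF c(1) uv] by linarith
      then show "u = c \<and> v \<in> Y \<or> v = c \<and> u \<in> Y \<or> v \<in> Z \<and> u = f v \<or> u \<in> Z \<and> v = f u"
        using up[OF uv] up[OF arcs_symmetric[OF uv]] by cases auto
    next
      assume "u = c \<and> v \<in> Y \<or> v = c \<and> u \<in> Y \<or> v \<in> Z \<and> u = f v \<or> u \<in> Z \<and> v = f u"
      then show "(u, v) \<in> E" using Yc f arcs_symmetric by auto
    qed
    show "V = insert c (Y \<union> Z)" by (rule VYZ)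
  qed (use c fY in \<open>auto simp: Y_def Z_def\<close>)
  moreover have "insert c Z = {u \<in> V. u \<in> A \<longleftrightarrow> c \<in> A}" "Y = {u \<in> V. u \<in> A \<longleftrightarrow> c \<notin> A}"
  proof -
    have "(u \<in> A \<longleftrightarrow> c \<in> A) \<longleftrightarrow> u \<in> insert c Z" "(u \<in> A \<longleftrightarrow> c \<notin> A) \<longleftrightarrow> u \<in> Y" if u: "u \<in> V" for u
    proof -
      have "u \<in> insert c Z \<longleftrightarrow> u = c \<or> d c u = 2" "u \<in> Y \<longleftrightarrow> d c u = 1"
        using u by (simp_all add: Y_def Z_def)
      moreover have "even (d c u) \<longleftrightarrow> u = c \<or> d c u = 2" "odd (d c u) \<longleftrightarrow> d c u = 1"
        using level[OF u] dist_self[OF c(1)] by auto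
      moreover have "even (d c u) \<longleftrightarrow> (c \<in> A \<longleftrightarrow> u \<in> A)" using dist_parity[OF c(1) u] .
      ultimately show "(u \<in> A \<longleftrightarrow> c \<in> A) \<longleftrightarrow> u \<in> insert c Z" "(u \<in> A \<longleftrightarrow> c \<notin> A) \<longleftrightarrow> u \<in> Y"
        by blast+
    qed
    then show "insert c Z = {u \<in> V. u \<in> A \<longleftrightarrow> c \<in> A}" "Y = {u \<in> V. u \<in> A \<longleftrightarrow> c \<notin> A}"
      using VYZ by auto
  qed
  then have "insert c Z = A \<and> Y = B \<or> insert c Z = B \<and> Y = A"
    using pverts_eq AB_disjoint by (cases "c \<in> A") auto
  ultimately show ?thesis by (rule that)
qed

text \<open>Indexed form of a walk, needed to address the arcs of a cycle modulo its length.\<close>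

lemma pcas_consecutive:
  assumes "pcas u p v"
  shows "p \<noteq> [] \<Longrightarrow> fst (p ! 0) = u" "p \<noteq> [] \<Longrightarrow> snd (last p) = v"
    "Suc i < length p \<Longrightarrow> snd (p ! i) = fst (p ! Suc i)"
  using assms
proof (induction p arbitrary: u i)
  case (Cons e es)
  show "fst ((e # es) ! 0) = u" if "pcas u (e # es) v" for u
    using that by simp
  show "snd (last (e # es)) = v" if "pcas u (e # es) v" for u
    using that Cons.IH(2) by (cases es) auto
  show "snd ((e # es) ! i) = fst ((e # es) ! Suc i)"
    if "Suc i < length (e # es)" "pcas u (e # es) v" for u i
    using that Cons.IH(1,3) by (cases i) auto
qed auto

text \<open>A vertex of maximal rank on a cycle would have two neighbours of smaller rank.\<close>

lemma (in pair_sym_digraph) cycle_length_less_3: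
  fixes h :: "'a \<Rightarrow> nat"
  assumes neq: "\<And>u v. (u, v) \<in> parcs G \<Longrightarrow> h u \<noteq> h v"
    and unique: "\<And>u v w. \<lbrakk>(u, v) \<in> parcs G; (w, v) \<in> parcs G; h u < h v; h w < h v\<rbrakk> \<Longrightarrow> u = w"
    and "cycle p"
  shows "length p < 3"
proof (rule ccontr)
  define n where "n = length p"
  assume "\<not> length p < 3"
  then have n: "3 \<le> n" by (simp add: n_def)
  then have ne: "p \<noteq> []" by (auto simp: n_def)
  from \<open>cycle p\<close> obtain u where "awalk u p u" and dist: "distinct (tl (awalk_verts u p))"
    unfolding cycle_def by blast
  then have cas: "pcas u p u" and sub: "set p \<subseteq> parcs G" by (auto simp: awalk_def)
  have "awalk_verts u p = fst (hd p) # map snd p"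
    using awalk_verts_conv'[OF cas] ne by simp
  with dist have dist: "distinct (map snd p)" by simp
  \<comment> \<open>The \<open>mod n\<close> closes the walk: the head of the last arc is the tail
    of the first.\<close>
  have next_arc: "snd (p ! i) = fst (p ! (Suc i mod n))" if i: "i < n" for i
  proof (cases "Suc i < n")
    case True
    then show ?thesis using pcas_consecutive(3)[OF cas] by (simp add: n_def)
  next
    case False
    with i have "Suc i = n" by simp
    moreover from this have "last p = p ! i"
      using ne by (metis last_conv_nth n_def diff_Suc_1)
    ultimately show ?thesis using pcas_consecutive(1,2)[OF cas] ne by simp
  qed
  obtain i where i: "i < n" and max: "\<And>j. j < n \<Longrightarrow> h (snd (p ! j)) \<le> h (snd (p ! i))"
  proof -
    have "finite ((\<lambda>i. h (snd (p ! i))) ` {..<n})" "(\<lambda>i. h (snd (p ! i))) ` {..<n} \<noteq> {}"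
      using n by (auto simp: lessThan_empty_iff)
    from Max_in[OF this] Max_ge[OF this(1)] that show ?thesis by fastforce
  qed
  define k where "k = (if i = 0 then n - 1 else i - 1)"
  define j where "j = Suc i mod n"
  \<comment> \<open>The cyclic predecessor \<open>k\<close> and successor \<open>j\<close> of
    \<open>i\<close> differ because \<open>n\<close> is at least 3.\<close>
  have kj: "k < n" "j < n" "Suc k mod n = i" "k \<noteq> j"
    using i n by (auto simp: k_def j_def mod_Suc)
  have pi: "p ! i \<in> parcs G" and pj: "p ! j \<in> parcs G"
    using sub i kj by (auto simp: n_def)
  have fst_i: "fst (p ! i) = snd (p ! k)" using next_arc[OF kj(1)] kj(3) by simp
  have fst_j: "fst (p ! j) = snd (p ! i)" using next_arc[OF i] by (simp add: j_def)
  have "(snd (p ! k), snd (p ! i)) \<in> parcs G" using pi fst_i by (metis prod.collapse)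
  moreover have "(snd (p ! j), snd (p ! i)) \<in> parcs G"
    using pj fst_j arcs_symmetric by (metis prod.collapse)
  \<comment> \<open>Both neighbours have strictly smaller rank: at most the maximum, and different
    from it because ranks differ along arcs.\<close>
  ultimately have "snd (p ! k) = snd (p ! j)"
    using max[OF kj(1)] max[OF kj(2)] neq le_neq_implies_less unique by metis
  with dist kj show False by (simp add: n_def distinct_conv_nth)
qed

section \<open>Two-level graphs are bipartitioned trees\<close>

context two_level
begin

definition rank :: "'a \<Rightarrow> nat" where
  "rank v = (if v = c then 0 else if v \<in> Y then 1 else 2)"

lemma f_neq:
  assumes "z \<in> Z"
  shows "f z \<noteq> z" "f z \<notin> Z" "f z \<noteq> c"
  using assms f_in[OF assms] c_notin YZ_disjoint by auto

lemma pair_graph_G: "pair_graph G"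
proof
  have "parcs G \<subseteq> pverts G \<times> pverts G"
    using f_in by (auto simp: parcs_iff verts_G)
  then show "finite (parcs G)"
    by (rule finite_subset) (simp add: verts_G finite_Y finite_Z)
  show "symmetric (with_proj G)"
    unfolding symmetric_def with_proj_simps by (rule symI) (auto simp: parcs_iff)
qed (use finite_Y finite_Z c_notin YZ_disjoint f_in f_neq f_neq(1)[symmetric] in \<open>auto simp: parcs_iff verts_G\<close>)

text \<open>The end of smaller rank is computed from the other end, which yields the uniqueness
  hypothesis of \<open>cycle_length_less_3\<close>.\<close>

lemma rank_arc:
  assumes "(u, v) \<in> parcs G" "rank u < rank v"
  shows "u = (if v \<in> Z then f v else c)"
  using assms f_in c_notin YZ_disjoint by (auto simp: parcs_iff rank_def split: if_splits)

text \<open>Every vertex is reached from \<open>c\<close> in at most two steps, and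
  \<open>rank\<close> excludes cycles. This makes the distance theory of bipartitioned trees
  available for every two-level graph.\<close>

lemma bipartitioned_tree: "bipartitioned_tree G (insert c Z) Y"
proof -
  interpret pair_graph G by (rule pair_graph_G)
  show ?thesis
  proof
    have from_c: "(c, v) \<in> (parcs G)\<^sup>*" if "v \<in> pverts G" for v
    proof -
      consider "v = c" | "v \<in> Y" | "v \<in> Z" using \<open>v \<in> pverts G\<close> verts_G by auto
      then show ?thesis
      proof cases
        case 3
        then have "(c, f v) \<in> parcs G" "(f v, v) \<in> parcs G" using f_in by (auto simp: parcs_iff)
        then show ?thesis by auto
      qed (auto simp: parcs_iff)
    qed
    have "sym ((parcs G)\<^sup>*)" using arcs_symmetric by (intro sym_rtrancl symI)
    then have "(u, v) \<in> (parcs G)\<^sup>*" if "u \<in> pverts G" "v \<in> pverts G" for u v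
      using from_c[OF that(1)] from_c[OF that(2)] by (meson rtrancl_trans symD)
    then have "(u, v) \<in> rtrancl_on (pverts G) (parcs G)"
      if "u \<in> pverts G" "v \<in> pverts G" for u v
      using that in_arcsD2 by (intro rtrancl_consistent_rtrancl_on) blast+
    \<comment> \<open>\<open>connected\<close> refers to the symmetric closure, which here is the
      arc set itself.\<close>
    moreover have "(parcs G)\<^sup>s = parcs G"
      using arcs_symmetric by (auto simp: symcl_def)
    ultimately show "connected (with_proj G)"
      by (simp add: connected_conv) (simp add: verts_G)
    fix w assume "cycle w"
    then show "length w < 3"
    proof (rule cycle_length_less_3[of rank, rotated 2])
      show "rank u \<noteq> rank v" if "(u, v) \<in> parcs G" for u v
        using that f_in c_notin YZ_disjoint by (auto simp: parcs_iff rank_def)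
      show "u = w" if "(u, v) \<in> parcs G" "(w, v) \<in> parcs G" "rank u < rank v" "rank w < rank v"
        for u v w
        using rank_arc that by metis
    qed
  qed (use c_notin YZ_disjoint f_in in \<open>auto simp: parcs_iff verts_G\<close>)
qed

sublocale bipartitioned_tree G "insert c Z" Y
  by (rule bipartitioned_tree)

section \<open>Distances, distance sums and eccentricities by level\<close>

abbreviation "fiber y \<equiv> {z \<in> Z. f z = y}"

lemma in_V [simp]: "c \<in> V" "y \<in> Y \<Longrightarrow> y \<in> V" "z \<in> Z \<Longrightarrow> z \<in> V"
  by (auto simp: verts_G)

lemma arcs [simp]: "y \<in> Y \<Longrightarrow> (c, y) \<in> E" "y \<in> Y \<Longrightarrow> (y, c) \<in> E"
  "z \<in> Z \<Longrightarrow> (f z, z) \<in> E" "z \<in> Z \<Longrightarrow> (z, f z) \<in> E"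
  by (auto simp: parcs_iff)

lemma dist_c_Y: "y \<in> Y \<Longrightarrow> d c y = 1"
  using arc_iff[of c y] by simp

lemma dist_c_Z:
  assumes "z \<in> Z"
  shows "d c z = 2"
proof -
  have "d c z \<le> 2" using dist_arc_le[of c "f z" z] dist_c_Y[of "f z"] assms f_in by simp
  moreover have "even (d c z)" "d c z \<noteq> 0"
    using dist_parity[of c z] dist_eq_0_iff[of c z] assms c_notin by auto
  ultimately show ?thesis by (auto elim!: evenE)
qed

lemma dist_Y_Y:
  assumes "y \<in> Y" "y' \<in> Y" "y \<noteq> y'"
  shows "d y y' = 2"
proof -
  have "d y y' \<le> 2"
    using dist_arc_le[of y c y'] dist_c_Y[of y] dist_sym[of c y] assms by simp
  moreover have "even (d y y')" "d y y' \<noteq> 0"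
    using dist_parity[of y y'] dist_eq_0_iff[of y y'] assms c_notin YZ_disjoint by auto
  ultimately show ?thesis by (auto elim!: evenE)
qed

lemma dist_Y_Z:
  assumes "y \<in> Y" "z \<in> Z"
  shows "d y z = (if f z = y then 1 else 3)"
proof (cases "f z = y")
  case True
  then show ?thesis using arc_iff[of y z] assms by auto
next
  case False
  have "d y z \<le> 3"
    using dist_arc_le[of y "f z" z] dist_Y_Y[of y "f z"] assms f_in False by simp
  moreover have "odd (d y z)"
    using dist_parity[of y z] assms c_notin YZ_disjoint by auto
  moreover have "d y z \<noteq> 1"
    using arc_iff[of y z] assms False c_notin YZ_disjoint by (auto simp: parcs_iff)
  ultimately show ?thesis using False by (auto elim!: oddE)
qed

text \<open>Parity leaves 2 and 4. A shortest walk enters \<open>z'\<close> through its only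
  neighbour \<open>f z'\<close>, so distance 2 forces a common parent.\<close>

lemma dist_Z_Z:
  assumes "z \<in> Z" "z' \<in> Z" "z \<noteq> z'"
  shows "d z z' = (if f z = f z' then 2 else 4)"
proof -
  have fY: "f z \<in> Y" "f z' \<in> Y" using assms f_in by auto
  have le: "d z z' \<le> Suc (d (f z') z)"
    using dist_arc_le[of z "f z'" z'] dist_sym[of z "f z'"] assms fY by simp
  have ev: "even (d z z')" "d z z' \<noteq> 0"
    using dist_parity[of z z'] dist_eq_0_iff[of z z'] assms by auto
  show ?thesis
  proof (cases "f z = f z'")
    case True
    then have "d z z' \<le> 2" using le dist_Y_Z[of "f z'" z] assms fY by simp
    with ev True show ?thesis by (auto elim!: evenE)
  next
    case False
    then have "d z z' \<le> 4" using le dist_Y_Z[of "f z'" z] assms fY by simp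
    moreover have "d z z' \<noteq> 2"
    proof
      assume two: "d z z' = 2"
      obtain w where w: "(w, z') \<in> E" "d z z' = Suc (d z w)"
        using ex_parent[of z z'] assms by auto
      then have "w = f z'" using assms c_notin YZ_disjoint fY by (auto simp: parcs_iff f_neq)
      then show False
        using two w dist_Y_Z[of "f z'" z] dist_sym[of z "f z'"] assms fY False by simp
    qed
    ultimately show ?thesis using ev False by (auto elim!: evenE)
  qed
qed

lemma sum_V: "(\<Sum>v\<in>V. g v) = g c + (\<Sum>y\<in>Y. g y) + (\<Sum>z\<in>Z. g z)"
  for g :: "'a \<Rightarrow> 'b::comm_monoid_add"
  using finite_Y finite_Z c_notin YZ_disjoint
  by (simp add: verts_G sum.union_disjoint add.assoc)

lemma distance_sum_eq:
  assumes "v \<in> V"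
  shows "distance_sum G v = d v c + (\<Sum>y\<in>Y. d v y) + (\<Sum>z\<in>Z. d v z)"
proof -
  have "distance_sum G v = (\<Sum>u\<in>V. d v u)"
    unfolding distance_sum_def using assms by (intro sum.cong) (auto simp: dist_sym)
  then show ?thesis by (simp add: sum_V)
qed

lemma distance_sum_c: "distance_sum G c = card Y + 2 * card Z"
  by (simp add: distance_sum_eq dist_c_Y dist_c_Z)

text \<open>Counting 2 for each vertex of \<open>Y\<close> and 3 for each of \<open>Z\<close>
  overestimates by 2 at \<open>y\<close> and at each of its children; the distance 1 to
  \<open>c\<close> reduces the first of these to 1.\<close>

lemma distance_sum_Y:
  assumes y: "y \<in> Y"
  shows "distance_sum G y + 2 * card (fiber y) + 1 = 2 * card Y + 3 * card Z"
proof -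
  have "(\<Sum>y'\<in>Y. d y y' + (if y' = y then 2 else 0)) = (\<Sum>y'\<in>Y. 2)"
    using y by (intro sum.cong) (auto simp: dist_Y_Y)
  then have "(\<Sum>y'\<in>Y. d y y') + 2 = 2 * card Y"
    using y finite_Y by (simp add: sum.distrib)
  moreover have "(\<Sum>z\<in>Z. d y z + (if f z = y then 2 else 0)) = (\<Sum>z\<in>Z. 3)"
    using y by (intro sum.cong) (auto simp: dist_Y_Z)
  then have "(\<Sum>z\<in>Z. d y z) + 2 * card (fiber y) = 3 * card Z"
    using finite_Z by (simp add: sum.distrib sum.inter_filter[symmetric])
  moreover have "d y c = 1" using y dist_c_Y dist_sym[of y c] by simp
  ultimately show ?thesis using y by (simp add: distance_sum_eq)
qed

lemma distance_sum_Z: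
  assumes z: "z \<in> Z"
  shows "distance_sum G z + 2 * card (fiber (f z)) + 2 = 3 * card Y + 4 * card Z"
proof -
  have "(\<Sum>y\<in>Y. d z y + (if y = f z then 2 else 0)) = (\<Sum>y\<in>Y. 3)"
    using z dist_sym[of z] by (intro sum.cong) (auto simp: dist_Y_Z)
  then have "(\<Sum>y\<in>Y. d z y) + 2 = 3 * card Y"
    using z f_in finite_Y by (simp add: sum.distrib)
  \<comment> \<open>\<open>z\<close> lies in its own fibre, so its distance 0 receives both
    corrections to reach 4.\<close>
  moreover have "(\<Sum>z'\<in>Z. d z z' + ((if f z' = f z then 2 else 0) + (if z' = z then 2 else 0)))
      = (\<Sum>z'\<in>Z. 4)"
    using z by (intro sum.cong) (auto simp: dist_Z_Z)
  then have "(\<Sum>z'\<in>Z. d z z') + 2 * card (fiber (f z)) + 2 = 4 * card Z"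
    using z finite_Z by (simp add: sum.distrib sum.inter_filter[symmetric])
  moreover have "d z c = 2" using z dist_c_Z dist_sym[of z c] by simp
  ultimately show ?thesis using z by (simp add: distance_sum_eq)
qed

lemma V_cases:
  assumes "v \<in> V"
  obtains "v = c" | "v \<in> Y" | "v \<in> Z"
  using assms by (auto simp: verts_G)

lemma eccentricity_c:
  assumes "z \<in> Z"
  shows "eccentricity G c = 2"
proof (rule eccentricity_eqI[OF pair_finite_verts, of z])
  show "d x c \<le> 2" if "x \<in> V" for x
    using that by (cases rule: V_cases) (auto simp: dist_sym[of _ c] dist_c_Y dist_c_Z)
qed (use assms in \<open>auto simp: dist_sym[of _ c] dist_c_Z\<close>)

lemma eccentricity_Y:
  assumes "y \<in> Y" "z \<in> Z" "f z \<noteq> y"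
  shows "eccentricity G y = 3"
proof (rule eccentricity_eqI[OF pair_finite_verts, of z])
  show "d x y \<le> 3" if "x \<in> V" for x
    using that assms dist_sym[of x y]
    by (cases rule: V_cases; cases "x = y") (auto simp: dist_c_Y dist_Y_Y dist_Y_Z)
qed (use assms in \<open>auto simp: dist_sym[of _ y] dist_Y_Z\<close>)

lemma eccentricity_Z:
  assumes "z \<in> Z" "z' \<in> Z" "f z' \<noteq> f z"
  shows "eccentricity G z = 4"
proof (rule eccentricity_eqI[OF pair_finite_verts, of z'])
  show "d x z \<le> 4" if "x \<in> V" for x
    using that assms
    by (cases rule: V_cases; cases "x = z") (auto simp: dist_c_Z dist_Y_Z dist_Z_Z)
qed (use assms dist_Z_Z[of z' z] in auto)

section \<open>Eccentric distance sums of two-level trees\<close>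

lemma sum_card_fiber: "(\<Sum>y\<in>Y. card (fiber y)) = card Z"
  using sum.group[of Z Y f "\<lambda>_. 1::nat"] finite_Y finite_Z f_in by auto

text \<open>The eccentricities are 2, 3 and 4 on the three levels. Over \<open>Y\<close> the fibre
  sizes add up to \<open>s\<close>; only the sum over \<open>Z\<close> depends on \<open>f\<close>,
  and it is the sum of the squared fibre sizes.\<close>

lemma eccentric_distance_sum_nonconst:
  assumes "z1 \<in> Z" "z2 \<in> Z" "f z1 \<noteq> f z2" and "t = int (card Y)" "s = int (card Z)"
  shows "int (eccentric_distance_sum G) =
    6 * t^2 - t + 21 * t * s - 10 * s + 16 * s^2 - 8 * int (\<Sum>z\<in>Z. card (fiber (f z)))"
proof -
  \<comment> \<open>No fibre is all of \<open>Z\<close>, so the eccentricities 3 and 4 are attained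
    everywhere on their levels.\<close>
  have other: "\<exists>z\<in>Z. f z \<noteq> y" for y using assms(1-3) by metis
  have "int (eccentricity G y * distance_sum G y) = 3 * (2 * t - 1 + 3 * s) - 6 * int (card (fiber y))"
    if "y \<in> Y" for y
  proof -
    from other obtain z where "z \<in> Z" "f z \<noteq> y" by blast
    then have "eccentricity G y = 3" using eccentricity_Y that by blast
    moreover have "int (distance_sum G y) = 2 * t - 1 + 3 * s - 2 * int (card (fiber y))"
      using distance_sum_Y[OF that] assms(4,5) by linarith
    ultimately show ?thesis by simp
  qed
  then have "(\<Sum>y\<in>Y. int (eccentricity G y * distance_sum G y))
      = (\<Sum>y\<in>Y. 3 * (2 * t - 1 + 3 * s) - 6 * int (card (fiber y)))"
    by (rule sum.cong[OF refl])
  also have "\<dots> = t * (3 * (2 * t - 1 + 3 * s)) - 6 * int (\<Sum>y\<in>Y. card (fiber y))"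
    using assms(4) by (simp add: sum_subtractf sum_distrib_left)
  also have "\<dots> = t * (3 * (2 * t - 1 + 3 * s)) - 6 * s"
    using assms(5) by (simp only: sum_card_fiber)
  finally have Y: "(\<Sum>y\<in>Y. int (eccentricity G y * distance_sum G y))
      = t * (3 * (2 * t - 1 + 3 * s)) - 6 * s" .
  have "int (eccentricity G z * distance_sum G z)
      = 4 * (3 * t + 4 * s - 2) - 8 * int (card (fiber (f z)))"
    if "z \<in> Z" for z
  proof -
    from other obtain z' where "z' \<in> Z" "f z' \<noteq> f z" by blast
    then have "eccentricity G z = 4" using eccentricity_Z that by blast
    moreover have "int (distance_sum G z) = 3 * t + 4 * s - 2 - 2 * int (card (fiber (f z)))"
      using distance_sum_Z[OF that] assms(4,5) by linarith
    ultimately show ?thesis by simp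
  qed
  then have "(\<Sum>z\<in>Z. int (eccentricity G z * distance_sum G z))
      = (\<Sum>z\<in>Z. 4 * (3 * t + 4 * s - 2) - 8 * int (card (fiber (f z))))"
    by (rule sum.cong[OF refl])
  also have "\<dots> = s * (4 * (3 * t + 4 * s - 2)) - 8 * int (\<Sum>z\<in>Z. card (fiber (f z)))"
    using assms(5) by (simp add: sum_subtractf sum_distrib_left)
  finally have Z: "(\<Sum>z\<in>Z. int (eccentricity G z * distance_sum G z))
      = s * (4 * (3 * t + 4 * s - 2)) - 8 * int (\<Sum>z\<in>Z. card (fiber (f z)))" .
  have "int (eccentricity G c * distance_sum G c) = 2 * (t + 2 * s)"
    using eccentricity_c[OF assms(1)] distance_sum_c assms(4,5) by simp
  moreover have "int (eccentric_distance_sum G) = int (eccentricity G c * distance_sum G c)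
      + (\<Sum>y\<in>Y. int (eccentricity G y * distance_sum G y))
      + (\<Sum>z\<in>Z. int (eccentricity G z * distance_sum G z))"
    unfolding eccentric_distance_sum_def of_nat_sum by (rule sum_V)
  ultimately show ?thesis unfolding Y Z by (simp add: algebra_simps power2_eq_square)
qed

text \<open>This is the double star: \<open>y0\<close> is a second centre of eccentricity 2, and all
  vertices other than \<open>c\<close> and \<open>y0\<close> have eccentricity 3. The
  \<open>+ 1\<close> in \<open>p\<close> counts \<open>c\<close>.\<close>

lemma eccentric_distance_sum_const:
  assumes y0: "y0 \<in> Y" "\<And>z. z \<in> Z \<Longrightarrow> f z = y0" and "2 \<le> card Y" "1 \<le> card Z"
    and q: "q = int (card Y)" and p: "p = int (card Z) + 1"
  shows "int (eccentric_distance_sum G) =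
    6 * p^2 + 6 * q^2 + 18 * p * q - 21 * p - 21 * q + 16"
proof -
  from \<open>1 \<le> card Z\<close> obtain z0 where z0: "z0 \<in> Z" by (cases "Z = {}") auto
  \<comment> \<open>A leaf \<open>y1\<close> at \<open>c\<close> is the farthest vertex from
    \<open>y0\<close> and from every vertex of \<open>Z\<close>.\<close>
  have "Y \<noteq> {y0}" using \<open>2 \<le> card Y\<close> by auto
  with y0 obtain y1 where y1: "y1 \<in> Y" "y1 \<noteq> y0" by auto
  have fib: "fiber y0 = Z" "y \<noteq> y0 \<Longrightarrow> fiber y = {}" for y using y0 by auto
  have ecc_y0: "eccentricity G y0 = 2"
  proof (rule eccentricity_eqI[OF pair_finite_verts, of y1])
    show "d x y0 \<le> 2" if "x \<in> V" for x
      using that y0 dist_sym[of x y0]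
      by (cases rule: V_cases; cases "x = y0") (auto simp: dist_c_Y dist_Y_Y dist_Y_Z)
  qed (use y0 y1 in \<open>auto simp: dist_Y_Y\<close>)
  have ecc_Z: "eccentricity G z = 3" if z: "z \<in> Z" for z
  proof (rule eccentricity_eqI[OF pair_finite_verts, of y1])
    show "d x z \<le> 3" if "x \<in> V" for x
      using that z y0
      by (cases rule: V_cases; cases "x = z") (auto simp: dist_c_Z dist_Y_Z dist_Z_Z)
  qed (use y0 y1 z in \<open>auto simp: dist_Y_Z\<close>)
  have "(\<Sum>y\<in>Y - {y0}. int (eccentricity G y * distance_sum G y))
      = (\<Sum>y\<in>Y - {y0}. 3 * (2 * q - 1 + 3 * (p - 1)))"
  proof (rule sum.cong[OF refl])
    fix y assume y: "y \<in> Y - {y0}"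
    then have "eccentricity G y = 3" using eccentricity_Y[of y z0] z0 y0 by auto
    moreover have "fiber y = {}" using fib(2) y by blast
    then have "card (fiber y) = 0" by (simp only: card.empty)
    then have "int (distance_sum G y) = 2 * q - 1 + 3 * (p - 1)"
      using distance_sum_Y[of y] y p q by simp
    ultimately show "int (eccentricity G y * distance_sum G y) = 3 * (2 * q - 1 + 3 * (p - 1))"
      by simp
  qed
  also have "\<dots> = (q - 1) * (3 * (2 * q - 1 + 3 * (p - 1)))"
    using y0 q finite_Y assms(3) by (simp add: of_nat_diff)
  finally have "(\<Sum>y\<in>Y - {y0}. int (eccentricity G y * distance_sum G y))
      = (q - 1) * (3 * (2 * q - 1 + 3 * (p - 1)))" .
  moreover have "int (eccentricity G y0 * distance_sum G y0) = 2 * (2 * q - 1 + (p - 1))"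
    using distance_sum_Y[of y0] y0 fib p q ecc_y0 by simp
  ultimately have Y: "(\<Sum>y\<in>Y. int (eccentricity G y * distance_sum G y))
      = 2 * (2 * q - 1 + (p - 1)) + (q - 1) * (3 * (2 * q - 1 + 3 * (p - 1)))"
    using finite_Y y0 by (simp only: sum.remove)
  have "(\<Sum>z\<in>Z. int (eccentricity G z * distance_sum G z))
      = (\<Sum>z\<in>Z. 3 * (3 * q - 2 + 2 * (p - 1)))"
  proof (rule sum.cong[OF refl])
    fix z assume z: "z \<in> Z"
    have "int (distance_sum G z) = 3 * q - 2 + 2 * (p - 1)"
      using distance_sum_Z[OF z] y0(2)[OF z] fib p q by simp
    with ecc_Z[OF z] show "int (eccentricity G z * distance_sum G z) = 3 * (3 * q - 2 + 2 * (p - 1))"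
      by simp
  qed
  also have "\<dots> = (p - 1) * (3 * (3 * q - 2 + 2 * (p - 1)))" using p by simp
  finally have Z: "(\<Sum>z\<in>Z. int (eccentricity G z * distance_sum G z))
      = (p - 1) * (3 * (3 * q - 2 + 2 * (p - 1)))" .
  have "int (eccentricity G c * distance_sum G c) = 2 * (q + 2 * (p - 1))"
    using eccentricity_c[OF z0] distance_sum_c p q by simp
  moreover have "int (eccentric_distance_sum G) = int (eccentricity G c * distance_sum G c)
      + (\<Sum>y\<in>Y. int (eccentricity G y * distance_sum G y))
      + (\<Sum>z\<in>Z. int (eccentricity G z * distance_sum G z))"
    unfolding eccentric_distance_sum_def of_nat_sum by (rule sum_V)
  ultimately show ?thesis unfolding Y Z by (simp add: algebra_simps power2_eq_square)
qed

end

section \<open>Isomorphisms\<close>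

text \<open>\<open>digraph_iso\<close> also asks for a map on arcs; since arcs are pairs,
  \<open>map_prod k k\<close> serves.\<close>

lemma graph_isoI:
  assumes wf: "pair_wf_digraph G" "pair_wf_digraph H"
    and bij: "bij_betw k (pverts G) (pverts H)"
    and arcs: "\<And>u v. \<lbrakk>u \<in> pverts G; v \<in> pverts G\<rbrakk> \<Longrightarrow> (k u, k v) \<in> parcs H \<longleftrightarrow> (u, v) \<in> parcs G"
  shows "graph_iso G H"
proof -
  interpret G: pair_wf_digraph G by (rule wf)
  interpret H: pair_wf_digraph H by (rule wf)
  let ?hom = "\<lparr>iso_verts = k, iso_arcs = map_prod k k, iso_head = snd, iso_tail = fst\<rparr>"
  have inj: "inj_on k (pverts G)" using bij by (rule bij_betw_imp_inj_on)
  have sub: "parcs G \<subseteq> pverts G \<times> pverts G" using G.in_arcsD1 G.in_arcsD2 by auto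
  have "inj_on (map_prod k k) (parcs G)"
    using map_prod_inj_on[OF inj inj] sub by (rule inj_on_subset)
  then have "G.digraph_isomorphism ?hom"
    using inj G.wf_digraph_axioms by (simp add: G.digraph_isomorphism_def)
  moreover have "map_prod k k ` parcs G = parcs H"
  proof (intro equalityI subsetI)
    fix e assume "e \<in> map_prod k k ` parcs G"
    then show "e \<in> parcs H" using arcs sub by auto
  next
    fix e assume e: "e \<in> parcs H"
    obtain x y where xy: "e = (x, y)" by (cases e)
    then have "x \<in> pverts H" "y \<in> pverts H" using e H.in_arcsD1 H.in_arcsD2 by auto
    then obtain u v where "u \<in> pverts G" "v \<in> pverts G" "x = k u" "y = k v"
      using bij_betw_imp_surj_on[OF bij] by blast
    then show "e \<in> map_prod k k ` parcs G" using arcs e xy by force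
  qed
  then have "with_proj H = app_iso ?hom (with_proj G)"
    using bij_betw_imp_surj_on[OF bij] by (simp add: app_iso_def with_proj_def)
  ultimately show ?thesis unfolding digraph_iso_def by blast
qed

text \<open>Heads and tails are preserved, so the arc map is induced by the vertex map. This much
  suffices to refute isomorphisms.\<close>

lemma graph_isoE:
  assumes "graph_iso G H"
  obtains k where "inj_on k (pverts G)" "\<And>u v. (u, v) \<in> parcs G \<Longrightarrow> (k u, k v) \<in> parcs H"
proof -
  from assms obtain hom where hom: "pre_digraph.digraph_isomorphism (with_proj G) hom"
    "with_proj H = app_iso hom (with_proj G)"
    unfolding digraph_iso_def by blast
  have H: "parcs H = iso_arcs hom ` parcs G" "iso_tail hom = fst" "iso_head hom = snd"
    using arg_cong[OF hom(2), of arcs] arg_cong[OF hom(2), of tail] arg_cong[OF hom(2), of head]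
    by simp_all
  have "(iso_verts hom u, iso_verts hom v) \<in> parcs H" if "(u, v) \<in> parcs G" for u v
  proof -
    have "iso_arcs hom (u, v) = (iso_verts hom u, iso_verts hom v)"
      using hom(1) H that by (force simp: pre_digraph.digraph_isomorphism_def prod_eq_iff)
    then show ?thesis using H that by force
  qed
  moreover have "inj_on (iso_verts hom) (pverts G)"
    using hom(1) by (simp add: pre_digraph.digraph_isomorphism_def)
  ultimately show ?thesis using that by blast
qed

text \<open>The arcs are given by the levels and the parent map, so level bijections compatible with
  the parent maps glue to an isomorphism.\<close>

lemma two_level_iso:
  assumes "two_level G c Y Z f" "two_level G' c' Y' Z' f'"
    and h: "bij_betw h Y Y'" and g: "bij_betw g Z Z'"
    and comm: "\<And>z. z \<in> Z \<Longrightarrow> f' (g z) = h (f z)"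
  shows "graph_iso G G'"
proof -
  interpret G: two_level G c Y Z f by fact
  interpret G': two_level G' c' Y' Z' f' by fact
  define k where "k v = (if v = c then c' else if v \<in> Y then h v else g v)" for v
  have k: "k c = c'" "\<And>y. y \<in> Y \<Longrightarrow> k y = h y" "\<And>z. z \<in> Z \<Longrightarrow> k z = g z"
    using G.c_notin G.YZ_disjoint by (auto simp: k_def)
  have hY: "h y \<in> Y'" if "y \<in> Y" for y using h that by (rule bij_betw_apply)
  have gZ: "g z \<in> Z'" if "z \<in> Z" for z using g that by (rule bij_betw_apply)
  have h_eq: "h y = h y' \<longleftrightarrow> y = y'" if "y \<in> Y" "y' \<in> Y" for y y'
    using h that by (auto dest: bij_betw_imp_inj_on inj_onD)
  show ?thesis
  proof (rule graph_isoI)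
    have "bij_betw k {c} {c'}" by (simp add: k bij_betw_def)
    moreover have "bij_betw k Y Y'" using h k by (subst bij_betw_cong) auto
    moreover have "bij_betw k Z Z'" using g k by (subst bij_betw_cong) auto
    ultimately have "bij_betw k ({c} \<union> (Y \<union> Z)) ({c'} \<union> (Y' \<union> Z'))"
      using G'.c_notin G'.YZ_disjoint by (intro bij_betw_combine) auto
    then show "bij_betw k (pverts G) (pverts G')" by (simp add: G.verts_G G'.verts_G)
    fix u v assume "u \<in> pverts G" "v \<in> pverts G"
    have ne: "h y \<noteq> c'" "h y \<notin> Z'" if "y \<in> Y" for y
      using hY[OF that] G'.c_notin G'.YZ_disjoint by auto
    have ne': "g z \<noteq> c'" "g z \<notin> Y'" if "z \<in> Z" for z
      using gZ[OF that] G'.c_notin G'.YZ_disjoint by auto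
    have ne'': "g z \<noteq> h y" "h y \<noteq> g z" if "z \<in> Z" "y \<in> Y" for z y
      using gZ[OF that(1)] hY[OF that(2)] G'.YZ_disjoint by auto
    note simps = k hY gZ ne ne(1)[symmetric] ne' ne'' comm h_eq G.parcs_iff G'.parcs_iff G.f_in
    from \<open>u \<in> pverts G\<close> show "(k u, k v) \<in> parcs G' \<longleftrightarrow> (u, v) \<in> parcs G"
    proof (cases rule: G.V_cases)
      case 1
      from \<open>v \<in> pverts G\<close> show ?thesis
        by (cases rule: G.V_cases) (use 1 G.c_notin G'.c_notin G.YZ_disjoint in \<open>auto simp: simps dest: G.f_neq(3) G'.f_neq(3)\<close>)
    next
      case 2
      from \<open>v \<in> pverts G\<close> show ?thesis
        by (cases rule: G.V_cases) (use 2 G.c_notin G.YZ_disjoint in \<open>auto simp: simps\<close>)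
    next
      case 3
      from \<open>v \<in> pverts G\<close> show ?thesis
        by (cases rule: G.V_cases)
          (use 3 G.c_notin G'.c_notin G.YZ_disjoint G.f_neq in \<open>auto simp: simps\<close>)
    qed
  qed (rule G.pair_wf_digraph G'.pair_wf_digraph)+
qed

text \<open>The complements have equal size. This lets the images of distinguished vertices be
  prescribed.\<close>

lemma bij_betw_extend:
  assumes "finite X" "finite X'" "card X = card X'"
    and S: "S \<subseteq> X" "S' \<subseteq> X'" "bij_betw k S S'"
  obtains h where "bij_betw h X X'" "\<And>x. x \<in> S \<Longrightarrow> h x = k x"
proof -
  have "card S = card S'" using S(3) by (rule bij_betw_same_card)
  then have "card (X - S) = card (X' - S')"
    using assms by (metis card_Diff_subset finite_subset)
  then obtain g where g: "bij_betw g (X - S) (X' - S')"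
    using finite_same_card_bij[of "X - S" "X' - S'"] assms by auto
  let ?h = "\<lambda>x. if x \<in> S then k x else g x"
  have "bij_betw ?h (S \<union> (X - S)) (S' \<union> (X' - S'))"
  proof (rule bij_betw_combine)
    show "bij_betw ?h S S'" using S(3) by (subst bij_betw_cong[of _ _ k]) auto
    show "bij_betw ?h (X - S) (X' - S')" using g by (subst bij_betw_cong[of _ _ g]) auto
  qed auto
  with S have "bij_betw ?h X X'" by (simp add: Un_absorb1)
  then show ?thesis by (rule that) simp
qed

section \<open>Double stars and the second extremal tree\<close>

text \<open>The centres are \<open>c\<close>, with \<open>q - 1\<close> leaves, and
  \<open>y0\<close>, with the \<open>p - 1\<close> leaves \<open>Z\<close>. In this form the
  formulas for two-level trees apply directly.\<close>

definition is_double_star :: "nat \<Rightarrow> nat \<Rightarrow> 'a pair_pre_digraph \<Rightarrow> bool" where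
  "is_double_star p q G \<longleftrightarrow> (\<exists>c Y Z f y0. two_level G c Y Z f \<and> y0 \<in> Y \<and> (\<forall>z\<in>Z. f z = y0) \<and>
     card Y = q \<and> card Z = p - 1)"

text \<open>Re-root at the other centre: the children of \<open>y0\<close> are \<open>c\<close> and
  \<open>Z\<close>, and the leaves at \<open>c\<close> become grandchildren.\<close>

lemma is_double_star_swap:
  assumes "is_double_star q p G" "1 \<le> p" "1 \<le> q"
  shows "is_double_star p q G"
proof -
  from assms(1) obtain c Y Z f y0 where G: "two_level G c Y Z f"
    and y0: "y0 \<in> Y" "\<And>z. z \<in> Z \<Longrightarrow> f z = y0" and card: "card Y = p" "card Z = q - 1"
    by (auto simp: is_double_star_def)
  interpret two_level G c Y Z f by fact
  have "two_level G y0 (insert c Z) (Y - {y0}) (\<lambda>_. c)"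
    using y0 finite_Y finite_Z c_notin YZ_disjoint
    by unfold_locales (auto simp: verts_G parcs_iff)
  moreover have "card (insert c Z) = q" "card (Y - {y0}) = p - 1"
    using card finite_Z finite_Y c_notin y0 assms(3) by auto
  ultimately show ?thesis unfolding is_double_star_def by blast
qed

lemma is_double_star_iso:
  assumes "is_double_star p q G" "is_double_star p q H"
  shows "graph_iso G H"
proof -
  from assms(1) obtain c Y Z f y0 where G: "two_level G c Y Z f"
    and y0: "y0 \<in> Y" "\<And>z. z \<in> Z \<Longrightarrow> f z = y0" and card: "card Y = q" "card Z = p - 1"
    by (auto simp: is_double_star_def)
  from assms(2) obtain c' Y' Z' f' y0' where H: "two_level H c' Y' Z' f'"
    and y0': "y0' \<in> Y'" "\<And>z. z \<in> Z' \<Longrightarrow> f' z = y0'" and card': "card Y' = q" "card Z' = p - 1"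
    by (auto simp: is_double_star_def)
  interpret G: two_level G c Y Z f by fact
  interpret H: two_level H c' Y' Z' f' by fact
  obtain h where h: "bij_betw h Y Y'" "h y0 = y0'"
    using bij_betw_extend[of Y Y' "{y0}" "{y0'}" "\<lambda>_. y0'"] y0 y0' card card'
      G.finite_Y H.finite_Y by (auto simp: bij_betw_def)
  obtain g where g: "bij_betw g Z Z'"
    using finite_same_card_bij G.finite_Z H.finite_Z card card' by metis
  from G H h(1) g show ?thesis
    by (rule two_level_iso) (use h y0 y0' bij_betw_apply[OF g] in simp)
qed

lemma eccentric_distance_sum_double_star:
  assumes "is_double_star p q G" "2 \<le> p" "2 \<le> q"
  shows "int (eccentric_distance_sum G) =
    6 * int p^2 + 6 * int q^2 + 18 * int p * int q - 21 * int p - 21 * int q + 16"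
proof -
  from assms(1) obtain c Y Z f y0 where G: "two_level G c Y Z f"
    and y0: "y0 \<in> Y" "\<And>z. z \<in> Z \<Longrightarrow> f z = y0" and card: "card Y = q" "card Z = p - 1"
    by (auto simp: is_double_star_def)
  interpret two_level G c Y Z f by fact
  show ?thesis
    using eccentric_distance_sum_const[OF y0, of "int q" "int p"] card assms(2,3) by simp
qed

text \<open>Take \<open>L\<close> with \<open>y1\<close> and \<open>y2\<close> as the children and
  \<open>P1\<close> with the single vertex \<open>z2\<close> of \<open>P2\<close> as the
  grandchildren; the parent map then has exactly one exceptional value.\<close>

lemma is_T1_iff:
  assumes "3 \<le> p" "3 \<le> q"
  shows "is_T1 p q G \<longleftrightarrow> (\<exists>c Y Z f y1 y2 z2. two_level G c Y Z f \<and> y1 \<in> Y \<and> y2 \<in> Y \<and> y1 \<noteq> y2 \<and>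
    z2 \<in> Z \<and> f z2 = y2 \<and> (\<forall>z\<in>Z - {z2}. f z = y1) \<and> card Y = q \<and> card Z = p - 1)"
    (is "_ \<longleftrightarrow> ?rhs")
proof
  assume "is_T1 p q G"
  then obtain c y1 y2 L P1 P2 where d: "distinct [c, y1, y2]"
    and fin: "finite L" "finite P1" "finite P2"
    and disj: "L \<inter> {c, y1, y2} = {}" "P1 \<inter> ({c, y1, y2} \<union> L) = {}"
      "P2 \<inter> ({c, y1, y2} \<union> L \<union> P1) = {}"
    and card: "card L = q - 2" "card P1 = p - 2" "card P2 = 1"
    and verts: "pverts G = {c, y1, y2} \<union> L \<union> P1 \<union> P2"
    and arcs: "parcs G = ({c} \<times> ({y1, y2} \<union> L) \<union> {y1} \<times> P1 \<union> {y2} \<times> P2)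
      \<union> ({c} \<times> ({y1, y2} \<union> L) \<union> {y1} \<times> P1 \<union> {y2} \<times> P2)\<inverse>"
    unfolding is_T1_def Let_def by (elim exE conjE) (rule that)
  from card(3) obtain z2 where P2: "P2 = {z2}" by (auto simp: card_1_singleton_iff)
  define Y where "Y = {y1, y2} \<union> L"
  define Z where "Z = insert z2 P1"
  define f where "f z = (if z = z2 then y2 else y1)" for z
  have "two_level G c Y Z f"
  proof
    show "(u, v) \<in> parcs G \<longleftrightarrow>
      u = c \<and> v \<in> Y \<or> v = c \<and> u \<in> Y \<or> v \<in> Z \<and> u = f v \<or> u \<in> Z \<and> v = f u" for u v
      unfolding arcs Y_def Z_def f_def P2 using disj(3) by (auto simp: P2)
  qed (use d fin disj in \<open>auto simp: verts P2 Y_def Z_def f_def\<close>)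
  moreover have "card Y = q"
    using d fin disj card assms by (simp add: Y_def card_insert_if)
  moreover have "card Z = p - 1"
    using fin disj card assms by (simp add: Z_def P2)
  moreover have "y1 \<in> Y" "y2 \<in> Y" "y1 \<noteq> y2" "z2 \<in> Z" "f z2 = y2" "\<forall>z\<in>Z - {z2}. f z = y1"
    using d by (auto simp: Y_def Z_def f_def)
  ultimately show ?rhs by blast
next
  assume ?rhs
  then obtain c Y Z f y1 y2 z2 where G: "two_level G c Y Z f" and y: "y1 \<in> Y" "y2 \<in> Y" "y1 \<noteq> y2"
    and z2: "z2 \<in> Z" "f z2 = y2" "\<And>z. z \<in> Z \<Longrightarrow> z \<noteq> z2 \<Longrightarrow> f z = y1"
    and card: "card Y = q" "card Z = p - 1"
    by auto
  interpret two_level G c Y Z f by fact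
  have E: "parcs G = ({c} \<times> ({y1, y2} \<union> (Y - {y1, y2})) \<union> {y1} \<times> (Z - {z2}) \<union> {y2} \<times> {z2})
    \<union> ({c} \<times> ({y1, y2} \<union> (Y - {y1, y2})) \<union> {y1} \<times> (Z - {z2}) \<union> {y2} \<times> {z2})\<inverse>"
  proof (intro set_eqI)
    fix e :: "'a \<times> 'a"
    obtain u v where e: "e = (u, v)" by (cases e)
    have f: "v \<in> Z \<and> u = f v \<longleftrightarrow> v = z2 \<and> u = y2 \<or> v \<in> Z \<and> v \<noteq> z2 \<and> u = y1" for u v
      using z2 by metis
    have Y: "{y1, y2} \<union> (Y - {y1, y2}) = Y" using y by auto
    show "e \<in> parcs G \<longleftrightarrow>
      e \<in> ({c} \<times> ({y1, y2} \<union> (Y - {y1, y2})) \<union> {y1} \<times> (Z - {z2}) \<union> {y2} \<times> {z2})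
        \<union> ({c} \<times> ({y1, y2} \<union> (Y - {y1, y2})) \<union> {y1} \<times> (Z - {z2}) \<union> {y2} \<times> {z2})\<inverse>"
      unfolding e parcs_iff f Y by auto
  qed
  show "is_T1 p q G"
    unfolding is_T1_def Let_def
  proof (intro exI conjI)
    show "distinct [c, y1, y2]" using y c_notin by auto
    show "finite (Y - {y1, y2})" "finite (Z - {z2})" "finite {z2}"
      using finite_Y finite_Z by auto
    show "card (Y - {y1, y2}) = q - 2" "card (Z - {z2}) = p - 2" "card {z2} = 1"
      using y z2 card finite_Y finite_Z by (simp_all add: card_Diff_subset)
    show "pverts G = {c, y1, y2} \<union> (Y - {y1, y2}) \<union> (Z - {z2}) \<union> {z2}"
      using y z2 verts_G by auto
  qed (use y z2 c_notin YZ_disjoint E in auto)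
qed

lemma is_T1_iso:
  assumes "is_T1 p q G" "is_T1 p q H" "3 \<le> p" "3 \<le> q"
  shows "graph_iso G H"
proof -
  from assms obtain c Y Z f y1 y2 z2 where G: "two_level G c Y Z f"
    and y: "y1 \<in> Y" "y2 \<in> Y" "y1 \<noteq> y2"
    and z2: "z2 \<in> Z" "f z2 = y2" "\<And>z. z \<in> Z \<Longrightarrow> z \<noteq> z2 \<Longrightarrow> f z = y1"
    and card: "card Y = q" "card Z = p - 1"
    by (auto simp: is_T1_iff)
  from assms obtain c' Y' Z' f' y1' y2' z2' where H: "two_level H c' Y' Z' f'"
    and y': "y1' \<in> Y'" "y2' \<in> Y'" "y1' \<noteq> y2'"
    and z2': "z2' \<in> Z'" "f' z2' = y2'" "\<And>z. z \<in> Z' \<Longrightarrow> z \<noteq> z2' \<Longrightarrow> f' z = y1'"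
    and card': "card Y' = q" "card Z' = p - 1"
    by (auto simp: is_T1_iff)
  interpret G: two_level G c Y Z f by fact
  interpret H: two_level H c' Y' Z' f' by fact
  have "bij_betw (\<lambda>x. if x = y1 then y1' else y2') {y1, y2} {y1', y2'}"
    using y y' by (auto simp: bij_betw_def inj_on_def)
  with y y' card card' obtain h where h: "bij_betw h Y Y'"
    "\<And>x. x \<in> {y1, y2} \<Longrightarrow> h x = (if x = y1 then y1' else y2')"
    using bij_betw_extend[of Y Y' "{y1, y2}" "{y1', y2'}" "\<lambda>x. if x = y1 then y1' else y2'"]
      G.finite_Y H.finite_Y by auto
  obtain g where g: "bij_betw g Z Z'" "g z2 = z2'"
    using bij_betw_extend[of Z Z' "{z2}" "{z2'}" "\<lambda>_. z2'"] z2 z2' card card'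
      G.finite_Z H.finite_Z by (auto simp: bij_betw_def)
  from G H h(1) g(1) show ?thesis
  proof (rule two_level_iso)
    fix z assume z: "z \<in> Z"
    show "f' (g z) = h (f z)"
    proof (cases "z = z2")
      case True
      then show ?thesis using h(2)[of y2] g(2) z2 z2' y by auto
    next
      case False
      then have "g z \<noteq> z2'" using g z z2(1) by (metis bij_betw_imp_inj_on inj_onD)
      then show ?thesis using h(2)[of y1] z z2(3) z2'(3) False bij_betw_apply[OF g(1) z] by simp
    qed
  qed
qed

text \<open>The eccentric distance sum of \<open>T\<^sub>1\<close>.\<close>

definition T1_value :: "int \<Rightarrow> int \<Rightarrow> int" where
  "T1_value p q = 8 * p^2 + 6 * q^2 + 21 * p * q - 10 * p - 22 * q - 14"

text \<open>The smaller side of the first inequality is the value of a double star, the larger side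
  of the second is the bound of \<open>eccentric_distance_sum_ge\<close>. Writing
  \<open>p = 3 + a\<close> and \<open>q = 3 + a + b\<close> turns both differences into polynomials
  with positive coefficients; the second is just 1 at \<open>p = q = 3\<close>.\<close>

lemma T1_value_less:
  assumes "3 \<le> p" "p \<le> q"
  shows "6 * p^2 + 6 * q^2 + 18 * p * q - 21 * p - 21 * q + 16 < T1_value p q"
    and "T1_value p q < 24 * p * q + 8 * p^2 + 8 * q^2 - 29 * p - 29 * q + 20"
proof -
  define a b where "a = p - 3" and "b = q - p"
  then have pq: "p = 3 + a" "q = 3 + a + b" and "0 \<le> a" "0 \<le> b" using assms by auto
  then have nonneg: "0 \<le> a * a" "0 \<le> a * b" "0 \<le> b * b" by auto
  have "T1_value p q - (6 * p^2 + 6 * q^2 + 18 * p * q - 21 * p - 21 * q + 16)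
      = 45 + 40 * a + 8 * b + 5 * (a * a) + 3 * (a * b)"
    by (simp add: pq T1_value_def algebra_simps power2_eq_square)
  then show "6 * p^2 + 6 * q^2 + 18 * p * q - 21 * p - 21 * q + 16 < T1_value p q"
    using nonneg \<open>0 \<le> a\<close> \<open>0 \<le> b\<close> by linarith
  have "24 * p * q + 8 * p^2 + 8 * q^2 - 29 * p - 29 * q + 20 - T1_value p q
      = 1 + 4 * a + 14 * b + 5 * (a * a) + 7 * (a * b) + 2 * (b * b)"
    by (simp add: pq T1_value_def algebra_simps power2_eq_square)
  then show "T1_value p q < 24 * p * q + 8 * p^2 + 8 * q^2 - 29 * p - 29 * q + 20"
    using nonneg \<open>0 \<le> a\<close> \<open>0 \<le> b\<close> by linarith
qed

text \<open>Exchanged arguments belong to a centre in the larger part, which has only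
  \<open>p\<close> neighbours.\<close>

lemma T1_value_swap_less:
  assumes "0 < p" "p < q"
  shows "T1_value p q < T1_value q p"
proof -
  have "T1_value q p - T1_value p q = (q - p) * (2 * (p + q) + 12)"
    by (simp add: T1_value_def algebra_simps power2_eq_square)
  also have "\<dots> > 0" using assms by simp
  finally show ?thesis by simp
qed

text \<open>The nonempty fibres have sizes \<open>p - 2\<close> and 1, so the squares add up to
  \<open>(p - 2)^2 + 1\<close>.\<close>

lemma eccentric_distance_sum_T1:
  assumes "is_T1 p q G" "3 \<le> p" "3 \<le> q"
  shows "int (eccentric_distance_sum G) = T1_value (int p) (int q)"
proof -
  from assms obtain c Y Z f y1 y2 z2 where G: "two_level G c Y Z f"
    and y: "y1 \<in> Y" "y2 \<in> Y" "y1 \<noteq> y2"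
    and z2: "z2 \<in> Z" "f z2 = y2" "\<And>z. z \<in> Z \<Longrightarrow> z \<noteq> z2 \<Longrightarrow> f z = y1"
    and card: "card Y = q" "card Z = p - 1"
    by (auto simp: is_T1_iff)
  interpret two_level G c Y Z f by fact
  have cardZ: "card (Z - {z2}) = p - 2" using z2 card finite_Z by simp
  then obtain z1 where z1: "z1 \<in> Z" "z1 \<noteq> z2" using assms(2)
    by (metis DiffE card.empty equals0I insertCI nat_less_le numeral_3_eq_3 numeral_2_eq_2
        zero_less_diff less_eq_Suc_le)
  have fib: "fiber y1 = Z - {z2}" "fiber y2 = {z2}" using z2 y by auto
  have "(\<Sum>z\<in>Z. card (fiber (f z))) = card (fiber (f z2)) + (\<Sum>z\<in>Z - {z2}. card (fiber (f z)))"
    using z2(1) finite_Z by (rule sum.remove[rotated])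
  also have "(\<Sum>z\<in>Z - {z2}. card (fiber (f z))) = (\<Sum>z\<in>Z - {z2}. p - 2)"
    using z2(3) cardZ fib by (intro sum.cong) auto
  finally have "(\<Sum>z\<in>Z. card (fiber (f z))) = 1 + (p - 2) * (p - 2)"
    using fib z2(2) cardZ by simp
  then have "int (\<Sum>z\<in>Z. card (fiber (f z))) = 1 + (int p - 2) * (int p - 2)"
    using assms(2) by (simp only: of_nat_add of_nat_mult of_nat_diff) simp
  moreover have "f z1 \<noteq> f z2" using z1 z2 y by simp
  ultimately show ?thesis
    using eccentric_distance_sum_nonconst[OF z1(1) z2(1), of "int q" "int p - 1"] card assms(2)
    by (simp add: T1_value_def algebra_simps power2_eq_square of_nat_diff)
qed

text \<open>The cases are: \<open>f\<close> constant; some fibre missing exactly one element of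
  \<open>Z\<close>; every fibre missing at least two.\<close>

lemma (in two_level) two_level_cases:
  assumes "2 \<le> card Z" "3 \<le> card Y" "card Z = p - 1" "card Y = q"
  obtains "is_double_star p q G" | "is_T1 p q G"
    | "T1_value (int p) (int q) < int (eccentric_distance_sum G)"
proof (cases "\<exists>z1\<in>Z. \<exists>z2\<in>Z. f z1 \<noteq> f z2")
  case False
  obtain z0 where "z0 \<in> Z" using assms(1) by (cases "Z = {}") auto
  with False have "\<forall>z\<in>Z. f z = f z0" "f z0 \<in> Y" using f_in by blast+
  then have "is_double_star p q G"
    unfolding is_double_star_def using two_level_axioms assms by blast
  then show ?thesis by (rule that)
next
  case True
  then obtain z1 z2 where z: "z1 \<in> Z" "z2 \<in> Z" "f z1 \<noteq> f z2" by blast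
  show ?thesis
  proof (cases "\<exists>y\<in>Y. card Z \<le> card (fiber y) + 1")
    case True
    then obtain y1 where y1: "y1 \<in> Y" "card Z \<le> card (fiber y1) + 1" by blast
    have "card (Z - fiber y1) = card Z - card (fiber y1)"
      using finite_Z by (intro card_Diff_subset) auto
    moreover have "Z - fiber y1 \<noteq> {}" using z by auto
    then have "0 < card (Z - fiber y1)" using finite_Z by (simp add: card_gt_0_iff)
    \<comment> \<open>At most one element is missing by the choice of \<open>y1\<close>, and at
      least one because \<open>f\<close> is not constant.\<close>
    ultimately have "card (Z - fiber y1) = 1" using y1 by simp
    then obtain x where x: "Z - fiber y1 = {x}" by (auto simp: card_1_singleton_iff)
    then have "x \<in> Z" "f x \<noteq> y1" "\<forall>z\<in>Z - {x}. f z = y1" by auto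
    moreover have "3 \<le> p" "3 \<le> q" using assms by auto
    ultimately have "is_T1 p q G"
      using two_level_axioms y1(1) f_in[of x] assms(3,4)
      by (subst is_T1_iff) (blast, blast, metis)
    then show ?thesis by (rule that)
  next
    case False
    \<comment> \<open>The squares then add up to at most \<open>card Z * (card Z - 2)\<close>, which
      is 2 less than for \<open>T1\<close>; the coefficient 8 makes this a gap of at least
      16.\<close>
    have "card (fiber (f z)) \<le> card Z - 2" if "z \<in> Z" for z
      using False f_in[OF that] by fastforce
    then have "(\<Sum>z\<in>Z. card (fiber (f z))) \<le> card Z * (card Z - 2)"
      using sum_bounded_above[of Z "\<lambda>z. card (fiber (f z))"] by simp
    then have "int (\<Sum>z\<in>Z. card (fiber (f z))) \<le> int (card Z * (card Z - 2))"
      by (rule of_nat_mono)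
    also have "\<dots> = (int p - 1) * (int p - 3)"
      using assms by (simp add: of_nat_diff)
    finally have "int (\<Sum>z\<in>Z. card (fiber (f z))) \<le> (int p - 1) * (int p - 3)" .
    then have "T1_value (int p) (int q) < int (eccentric_distance_sum G)"
      using eccentric_distance_sum_nonconst[OF z, of "int q" "int p - 1"] assms
      by (simp add: T1_value_def algebra_simps power2_eq_square of_nat_diff)
    then show ?thesis by (rule that)
  qed
qed

lemma two_level_in_bipartite_trees:
  assumes "two_level G c Y Z f" "card Z = p - 1" "card Y = q" "1 \<le> p"
  shows "G \<in> bipartite_trees (p + q) p q"
proof -
  interpret two_level G c Y Z f by fact
  have "undirected_tree G"
    using pair_graph_G connected_G acyclic_G by (fastforce simp: undirected_tree_def)
  moreover have card: "card (insert c Z) = p" using assms c_notin finite_Z by simp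
  moreover have "has_bipartition G p q"
    unfolding has_bipartition_def
    using pverts_eq AB_disjoint parcs_subset card assms(3) by blast
  moreover have "card (pverts G) = p + q"
    unfolding pverts_eq using card assms(3) AB_disjoint finite_A finite_B
    by (subst card_Un_disjoint) auto
  ultimately show ?thesis by (simp add: bipartite_trees_def)
qed

text \<open>Without a vertex of eccentricity at most 2 the general lower bound exceeds
  \<open>T1_value\<close>. Otherwise the tree is two-level, and it matters which part contains the
  centre.\<close>

lemma bipartite_trees_cases:
  assumes "G \<in> bipartite_trees n p q" "3 \<le> p" "p \<le> q"
  obtains "is_double_star p q G" | "is_T1 p q G"
    | "T1_value (int p) (int q) < int (eccentric_distance_sum G)"
proof -
  from assms(1) obtain A B where AB: "pverts G = A \<union> B" "A \<inter> B = {}" "card A = p" "card B = q"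
    "parcs G \<subseteq> A \<times> B \<union> B \<times> A" and tree: "undirected_tree G"
    by (auto simp: bipartite_trees_def has_bipartition_def)
  from tree interpret pair_graph G by (simp add: undirected_tree_def)
  interpret bipartitioned_tree G A B
    using tree AB by unfold_locales (auto simp: undirected_tree_def not_le)
  show ?thesis
  proof (cases "\<exists>c\<in>V. eccentricity G c \<le> 2")
    case False
    then have "24 * int p * int q + 8 * int p^2 + 8 * int q^2 - 29 * int p - 29 * int q + 20
        \<le> int (eccentric_distance_sum G)"
      using AB assms by (intro eccentric_distance_sum_ge) force+
    moreover have "T1_value (int p) (int q)
        < 24 * int p * int q + 8 * int p^2 + 8 * int q^2 - 29 * int p - 29 * int q + 20"
      using assms by (intro T1_value_less) auto
    ultimately show ?thesis using that by linarith
  next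
    case True
    then obtain c where "c \<in> V" "eccentricity G c \<le> 2" by blast
    then obtain Y Z f where YZ: "two_level G c Y Z f"
      "insert c Z = A \<and> Y = B \<or> insert c Z = B \<and> Y = A"
      by (rule two_levelI)
    interpret YZ: two_level G c Y Z f by fact
    have card_Z: "card Z = card (insert c Z) - 1" using YZ.c_notin YZ.finite_Z by simp
    from YZ(2) show ?thesis
    proof
      assume "insert c Z = A \<and> Y = B"
      then have "card Z = p - 1" "card Y = q" using card_Z AB by auto
      moreover from this have "2 \<le> card Z" "3 \<le> card Y" using assms by auto
      ultimately show ?thesis using YZ.two_level_cases that by metis
    next
      \<comment> \<open>Here \<open>p\<close> and \<open>q\<close> are exchanged. A double star is
        re-rooted; in the other cases the exchanged value is strictly larger unless
        \<open>p = q\<close>.\<close>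
      assume "insert c Z = B \<and> Y = A"
      then have card: "card Z = q - 1" "card Y = p" using card_Z AB by auto
      have less: "T1_value (int p) (int q) < T1_value (int q) (int p)" if "p \<noteq> q"
        using that assms by (intro T1_value_swap_less) auto
      have "2 \<le> card Z" "3 \<le> card Y" using card assms by auto
      then show ?thesis using card
      proof (cases rule: YZ.two_level_cases)
        case 1
        then show ?thesis using is_double_star_swap[OF 1] assms that(1) by simp
      next
        case 2
        show ?thesis
        proof (cases "p = q")
          case True
          with 2 show ?thesis using that by simp
        next
          case False
          with 2 less assms that show ?thesis using eccentric_distance_sum_T1[OF 2] by simp
        qed
      next
        case 3
        then show ?thesis using that less by (cases "p = q") (simp, linarith)
      qed
    qed
  qed
qed

text \<open>A double star has no three disjoint edges.\<close>

lemma is_T1_not_iso_double_star: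
  assumes "is_T1 p q G" "is_double_star p' q' H" "3 \<le> p" "3 \<le> q"
  shows "\<not> graph_iso G H"
proof
  assume "graph_iso G H"
  then obtain k where k: "inj_on k (pverts G)"
    "\<And>u v. (u, v) \<in> parcs G \<Longrightarrow> (k u, k v) \<in> parcs H" by (rule graph_isoE) blast
  from assms(1) obtain c y1 y2 L P1 P2 where d: "distinct [c, y1, y2]"
    and disj: "L \<inter> {c, y1, y2} = {}" "P1 \<inter> ({c, y1, y2} \<union> L) = {}"
      "P2 \<inter> ({c, y1, y2} \<union> L \<union> P1) = {}"
    and card: "card L = q - 2" "card P1 = p - 2" "card P2 = 1"
    and verts: "pverts G = {c, y1, y2} \<union> L \<union> P1 \<union> P2"
    and arcs: "parcs G = ({c} \<times> ({y1, y2} \<union> L) \<union> {y1} \<times> P1 \<union> {y2} \<times> P2)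
      \<union> ({c} \<times> ({y1, y2} \<union> L) \<union> {y1} \<times> P1 \<union> {y2} \<times> P2)\<inverse>"
    unfolding is_T1_def Let_def by (elim exE conjE) (rule that)
  have "L \<noteq> {}" "P1 \<noteq> {}" "P2 \<noteq> {}" using card assms(3,4) by auto
  then obtain l z1 z2 where lz: "l \<in> L" "z1 \<in> P1" "z2 \<in> P2" by blast
  from assms(2) obtain c' Y Z f y0 where H: "two_level H c' Y Z f"
    and y0: "y0 \<in> Y" "\<And>z. z \<in> Z \<Longrightarrow> f z = y0"
    by (auto simp: is_double_star_def)
  interpret H: two_level H c' Y Z f by fact
  \<comment> \<open>The two centres of the double star meet all of its edges.\<close>
  have cover: "k u \<in> {c', y0} \<or> k v \<in> {c', y0}" if "(u, v) \<in> parcs G" for u v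
    using k(2)[OF that] y0 by (auto simp: H.parcs_iff)
  \<comment> \<open>The arcs \<open>(c, l)\<close>, \<open>(y1, z1)\<close> and
    \<open>(y2, z2)\<close> are disjoint, so their images would need three different
    centres.\<close>
  have "distinct [c, l, y1, z1, y2, z2]" "set [c, l, y1, z1, y2, z2] \<subseteq> pverts G"
    using d disj lz verts by auto
  then have "distinct (map k [c, l, y1, z1, y2, z2])"
    using k(1) by (simp only: distinct_map) (blast intro: inj_on_subset)
  moreover have "k c \<in> {c', y0} \<or> k l \<in> {c', y0}" "k y1 \<in> {c', y0} \<or> k z1 \<in> {c', y0}"
    "k y2 \<in> {c', y0} \<or> k z2 \<in> {c', y0}"
    using lz by (auto intro!: cover simp del: insert_iff simp: arcs)
  ultimately show False by auto
qed

theorem theorem4p3: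
  fixes p q n :: nat and T1 :: "'a pair_pre_digraph"
  assumes "3 \<le> p" and "p \<le> q" and "n = p + q"
    and "is_T1 p q T1"
  shows "unique_second_minimal_eds (bipartite_trees n p q) T1"
proof -
  let ?T = "bipartite_trees n p q :: 'a pair_pre_digraph set"
  have q: "3 \<le> q" using assms by simp
  obtain c Y Z f y1 where T1: "two_level T1 c Y Z f" and y1: "y1 \<in> Y"
    and card: "card Y = q" "card Z = p - 1"
    using assms(4) unfolding is_T1_iff[OF assms(1) q] by blast
  interpret T1: two_level T1 c Y Z f by fact
  \<comment> \<open>A double star over the same vertex type is needed as witness; it arises from
    \<open>T1\<close> by hanging all of \<open>Z\<close> on \<open>y1\<close>.\<close>
  define S where "S = \<lparr>pverts = pverts T1, parcs = {(u, v). u = c \<and> v \<in> Y \<or> v = c \<and> u \<in> Y \<or>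
    v \<in> Z \<and> u = y1 \<or> u \<in> Z \<and> v = y1}\<rparr>"
  have S: "two_level S c Y Z (\<lambda>_. y1)"
    using T1.finite_Y T1.finite_Z T1.c_notin T1.YZ_disjoint y1
    by unfold_locales (auto simp: S_def T1.verts_G)
  then have star_S: "is_double_star p q S" unfolding is_double_star_def using y1 card by blast
  have mem: "S \<in> ?T" "T1 \<in> ?T"
    using two_level_in_bipartite_trees[OF S] two_level_in_bipartite_trees[OF T1] card assms by auto
  have eds_T1: "int (eccentric_distance_sum G) = T1_value (int p) (int q)" if "is_T1 p q G"
    for G :: "'a pair_pre_digraph"
    using eccentric_distance_sum_T1[OF that assms(1) q] .
  have eds_star: "int (eccentric_distance_sum G) < T1_value (int p) (int q)"
    if "is_double_star p q G" for G :: "'a pair_pre_digraph"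
  proof -
    have "int (eccentric_distance_sum G) =
        6 * int p^2 + 6 * int q^2 + 18 * int p * int q - 21 * int p - 21 * int q + 16"
      using eccentric_distance_sum_double_star[OF that] assms q by simp
    also have "\<dots> < T1_value (int p) (int q)"
      using assms by (intro T1_value_less) auto
    finally show ?thesis .
  qed
  have ge: "T1_value (int p) (int q) \<le> int (eccentric_distance_sum G)"
    if "G \<in> ?T" "\<not> is_double_star p q G" for G
    using that(1) assms(1,2)
    by (cases rule: bipartite_trees_cases)
      (use that(2) eds_T1[of G] in auto)
  have eds_eq: "eccentric_distance_sum S = eccentric_distance_sum G" if "is_double_star p q G" for G
    using eccentric_distance_sum_double_star[OF star_S] eccentric_distance_sum_double_star[OF that]
      assms q by simp
  have "unique_minimal_eds ?T S"
    unfolding unique_minimal_eds_def minimal_eds_def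
  proof (intro conjI ballI allI impI)
    fix G assume G: "G \<in> ?T"
    show "eccentric_distance_sum S \<le> eccentric_distance_sum G"
      using eds_eq[of G] ge[OF G] eds_star[OF star_S] by (cases "is_double_star p q G") auto
  next
    fix G assume G: "G \<in> ?T \<and> (\<forall>T'\<in>?T. eccentric_distance_sum G \<le> eccentric_distance_sum T')"
    \<comment> \<open>By \<open>ge\<close>, a tree that is not a double star has at least the value
      of \<open>T1\<close>, which is strictly larger than that of \<open>S\<close>.\<close>
    then have "eccentric_distance_sum G \<le> eccentric_distance_sum S" using mem by blast
    then have "is_double_star p q G" using ge[of G] G eds_star[OF star_S] by fastforce
    then show "graph_iso G S" using star_S by (rule is_double_star_iso)
  qed (rule mem)
  moreover have "unique_minimal_eds {G \<in> ?T. \<not> graph_iso G S} T1"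
    unfolding unique_minimal_eds_def minimal_eds_def
  proof (intro conjI ballI allI impI)
    show "T1 \<in> {G \<in> ?T. \<not> graph_iso G S}"
      using mem is_T1_not_iso_double_star[OF assms(4) star_S assms(1) q] by simp
    fix G assume G: "G \<in> {G \<in> ?T. \<not> graph_iso G S}"
    \<comment> \<open>All double stars are isomorphic to \<open>S\<close>, so removing the copies of
      \<open>S\<close> removes every one of them.\<close>
    then have "\<not> is_double_star p q G" using is_double_star_iso[OF _ star_S] by blast
    then show "eccentric_distance_sum T1 \<le> eccentric_distance_sum G"
      using ge[of G] G eds_T1[OF assms(4)] by simp
  next
    fix G assume G: "G \<in> {G \<in> ?T. \<not> graph_iso G S} \<and>
      (\<forall>T'\<in>{G \<in> ?T. \<not> graph_iso G S}. eccentric_distance_sum G \<le> eccentric_distance_sum T')"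
    then have "eccentric_distance_sum G \<le> eccentric_distance_sum T1"
      using mem is_T1_not_iso_double_star[OF assms(4) star_S assms(1) q] by blast
    then have "\<not> T1_value (int p) (int q) < int (eccentric_distance_sum G)"
      using eds_T1[OF assms(4)] by simp
    moreover have "\<not> is_double_star p q G" using G is_double_star_iso[OF _ star_S] by blast
    moreover have "G \<in> ?T" using G by blast
    ultimately have "is_T1 p q G"
      using bipartite_trees_cases[OF _ assms(1,2)] by blast
    then show "graph_iso G T1" using is_T1_iso assms q by blast
  qed
  ultimately show ?thesis unfolding unique_second_minimal_eds_def by blast
qed

end
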